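(* Let $c\ge 2$ be a fixed integer and let $T$ be the rank-one transformation with, for every $n\ge 0$, $r_n=3$, $s_{n,0}=0$, $s_{n,1}=1$, and $s_{n,2}\ge 3h_n+1$ chosen so that $h_{n+1}=3^c h_n$ (so $h_n=3^{cn}$). Then $T$ is rationally weakly mixing.
   Context: Rank-one transformations. A column is a finite ordered collection of pairwise disjoint intervals of $\mathbb{R}$ (called levels), all of the same length, thought of as stacked on top of each other. The column map $T_C$ of a column $C$ sends each point of a level other than the top one to the point directly above it in the next level (by translation); it is undefined on the top level. A rank-one (cutting-and-stacking) transformation $T$ is given by a sequence of columns $C_n$, $n\ge 0$: $C_0$ consists of the single level $I=(0,1)$; $C_{n+1}$ is obtained from $C_n$ by cutting $C_n$ into $r_n\ge 2$ subcolumns of equal width (numbered $0,\dots,r_n-1$ from left to right), adding $s_{n,k}\ge 0$ new levels ("spacers", new disjoint intervals) above the $k$-th subcolumn, and stacking every subcolumn under the subcolumn to its right. $X$ is the union of all levels of all columns, with Lebesgue measure $\mu$ and its Borel $\sigma$-algebra, and the levels are required to form a generating semiring for the $\sigma$-algebra. $T_{C_{n+1}}$ extends $T_{C_n}$, and $T$ is the limit of the $T_{C_n}$; it is an invertible measure-preserving transformation of $X$ (mod null sets). $h_n$ denotes the number of levels of $C_n$. For measurable $F$ with $0<\mu(F)<\infty$, $u_k(F)=\mu(F\cap T^kF)/\mu(F)^2$ and $a_n(F)=\sum_{k=0}^{n-1}u_k(F)$. $T$ is rationally weakly mixing if there exists a measurable $F\subset X$ with $0<\mu(F)<\infty$ such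 that for all measurable $A,B\subset F$, $$\frac{1}{a_n(F)}\sum_{k=0}^{n-1}\left|\mu(A\cap T^kB)-\mu(A)\mu(B)u_k(F)\right|\to 0\quad\text{as } n\to\infty.$$ *)

theory Defs
  imports "HOL-Analysis.Analysis"
begin

section \<open>Columns\<close>

text \<open>All levels of a column have the same length, so a column is stored as that length together
  with the left endpoints of its levels, listed from bottom to top. Levels are open intervals, in
  accordance with the initial level \<open>(0,1)\<close>; cutting a level therefore discards finitely many
  cut points.\<close>

record column =
  width :: real
  lefts :: "real list"

definition height :: "column \<Rightarrow> nat"
  where "height C = length (lefts C)"

definition level :: "column \<Rightarrow> nat \<Rightarrow> real set"
  where "level C i = {lefts C ! i <..< lefts C ! i + width C}"

definition is_column :: "column \<Rightarrow> bool"
  where "is_column C \<longleftrightarrow> width C > 0 \<and> lefts C \<noteq> [] \<and> disjoint_family_on (level C) {..<height C}"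

definition column_map :: "column \<Rightarrow> real \<rightharpoonup> real"
  where "column_map C x =
    (if \<exists>i. Suc i < height C \<and> x \<in> level C i
     then let i = (THE i. Suc i < height C \<and> x \<in> level C i)
          in Some (x - lefts C ! i + lefts C ! Suc i)
     else None)"

section \<open>Cutting and stacking\<close>

text \<open>\<open>sp k\<close> lists the left endpoints of the spacers above the \<open>k\<close>-th subcolumn, from bottom to top.
  That the spacers are new and disjoint is expressed by requiring \<open>is_column C'\<close>: an
  open interval disjoint from all the subcolumns of \<open>C\<close> is disjoint from all the levels of \<open>C\<close>.\<close>

definition cut_and_stack :: "nat \<Rightarrow> (nat \<Rightarrow> nat) \<Rightarrow> column \<Rightarrow> column \<Rightarrow> bool"
  where "cut_and_stack r s C C' \<longleftrightarrow>
    is_column C' \<and>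
    (\<exists>sp :: nat \<Rightarrow> real list.
      (\<forall>k<r. length (sp k) = s k) \<and>
      width C' = width C / real r \<and>
      lefts C' = concat (map (\<lambda>k. map (\<lambda>a. a + real k * (width C / real r)) (lefts C) @ sp k) [0..<r]))"

definition column_levels :: "(nat \<Rightarrow> column) \<Rightarrow> real set set"
  where "column_levels C = (\<Union>n. level (C n) ` {..<height (C n)})"

definition column_space :: "(nat \<Rightarrow> column) \<Rightarrow> real measure"
  where "column_space C = restrict_space lborel (\<Union>(column_levels C))"

text \<open>Because of the discarded cut points, the semiring condition on differences and the generation
  of the \<open>\<sigma>\<close>-algebra are understood modulo null sets.\<close>

definition generating_semiring_mod_null :: "'a measure \<Rightarrow> 'a set set \<Rightarrow> bool"
  where "generating_semiring_mod_null M \<L> \<longleftrightarrow>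
    \<L> \<subseteq> sets M \<and> {} \<in> \<L> \<and>
    (\<forall>A\<in>\<L>. \<forall>B\<in>\<L>. A \<inter> B \<in> \<L>) \<and>
    (\<forall>A\<in>\<L>. \<forall>B\<in>\<L>. \<exists>\<F>\<subseteq>\<L>. finite \<F> \<and> disjoint \<F> \<and> sym_diff (A - B) (\<Union>\<F>) \<in> null_sets M) \<and>
    (\<forall>B\<in>sets M. \<exists>A\<in>sigma_sets (space M) \<L>. sym_diff A B \<in> null_sets M)"

text \<open>The limit \<open>T\<close> of the column maps is any total function extending all of them. Its values at
  points lying in the domain of no column map are left arbitrary; inside the space only countably
  many points are concerned.\<close>

definition rank_one_transformation ::
    "(nat \<Rightarrow> column) \<Rightarrow> (nat \<Rightarrow> nat) \<Rightarrow> (nat \<Rightarrow> nat \<Rightarrow> nat) \<Rightarrow> (real \<Rightarrow> real) \<Rightarrow> bool"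
  where "rank_one_transformation C r s T \<longleftrightarrow>
    C 0 = \<lparr>width = 1, lefts = [0]\<rparr> \<and>
    (\<forall>n. r n \<ge> 2 \<and> cut_and_stack (r n) (s n) (C n) (C (Suc n))) \<and>
    generating_semiring_mod_null (column_space C) (insert {} (column_levels C)) \<and>
    (\<forall>n. column_map (C n) \<subseteq>\<^sub>m (\<lambda>x. Some (T x)))"

section \<open>Rational weak mixing\<close>

definition return_coeff :: "'a measure \<Rightarrow> ('a \<Rightarrow> 'a) \<Rightarrow> 'a set \<Rightarrow> nat \<Rightarrow> real"
  where "return_coeff M T F k = measure M (F \<inter> (T ^^ k) ` F) / (measure M F)\<^sup>2"

definition return_sum :: "'a measure \<Rightarrow> ('a \<Rightarrow> 'a) \<Rightarrow> 'a set \<Rightarrow> nat \<Rightarrow> real"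
  where "return_sum M T F n = (\<Sum>k<n. return_coeff M T F k)"

definition rationally_weakly_mixing :: "'a measure \<Rightarrow> ('a \<Rightarrow> 'a) \<Rightarrow> bool"
  where "rationally_weakly_mixing M T \<longleftrightarrow>
    (\<exists>F\<in>sets M. 0 < emeasure M F \<and> emeasure M F < \<infinity> \<and>
      (\<forall>A\<in>sets M. \<forall>B\<in>sets M. A \<subseteq> F \<longrightarrow> B \<subseteq> F \<longrightarrow>
        (\<lambda>n. 1 / return_sum M T F n *
              (\<Sum>k<n. \<bar>measure M (A \<inter> (T ^^ k) ` B) - measure M A * measure M B * return_coeff M T F k\<bar>))
          \<longlonglongrightarrow> 0))"

end

theory Submission
  imports Defs "HOL-Real_Asymp.Real_Asymp"
begin

text \<open>Take \<open>F = (0,1)\<close>. The levels of \<open>C\<^sub>n\<close> inside \<open>F\<close> are those at the heights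
  \<open>\<Sum>i<n. d\<^sub>i\<close> with \<open>d\<^sub>i \<in> {0, h\<^sub>i, 2 h\<^sub>i + 1}\<close>, so for unions \<open>V\<close>, \<open>W\<close> of levels in \<open>F\<close> the number
  \<open>\<mu>(V \<inter> T\<^sup>k W)\<close> counts representations of \<open>k\<close> by differences of such digit sums. Passing to the
  next column convolves these counts with the law of the difference of two digits. This law puts
  mass \<open>4/9\<close> on the adjacent pairs \<open>\<plusminus>h\<^sub>i, \<plusminus>(h\<^sub>i + 1)\<close>, so the sum of many digit differences contains a
  binomial component with a growing number of fair coins; the total variation distance between its
  law and its translate by 1 therefore tends to 0. Hence the counts depend, in the \<open>\<ell>\<^sup>1\<close> sense, only
  on the measures of \<open>V\<close> and \<open>W\<close>. General \<open>A, B \<subseteq> F\<close> are approximated by such unions; the error is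
  controlled by \<open>\<Sum>k<N. \<mu>(A \<inter> T\<^sup>k B) \<le> 3\<^sup>n\<^sup>+\<^sup>2 min (\<mu> A) (\<mu> B)\<close> and \<open>a\<^sub>N(F) \<ge> 3\<^sup>n / 2\<close> for
  \<open>h\<^sub>n \<le> N < h\<^sub>n\<^sub>+\<^sub>1\<close>.\<close>

section \<open>Convolutions on the integers\<close>

text \<open>Bounding all finite partial sums states an l^1 bound without a separate summability
  condition. The final estimates only use finite sets of times.\<close>

definition l1_le :: "(int \<Rightarrow> real) \<Rightarrow> real \<Rightarrow> bool"
  where "l1_le f c \<longleftrightarrow> (\<forall>K. finite K \<longrightarrow> (\<Sum>k\<in>K. \<bar>f k\<bar>) \<le> c)"

lemma l1_le_mono: "l1_le f a \<Longrightarrow> a \<le> b \<Longrightarrow> l1_le f b"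
  unfolding l1_le_def by fastforce

lemma l1_le_zero: "l1_le (\<lambda>k. 0) 0"
  by (simp add: l1_le_def)

lemma l1_le_add:
  assumes "l1_le f a" "l1_le g b"
  shows "l1_le (\<lambda>k. f k + g k) (a + b)"
  unfolding l1_le_def
proof (intro allI impI)
  fix K :: "int set" assume K: "finite K"
  have "(\<Sum>k\<in>K. \<bar>f k + g k\<bar>) \<le> (\<Sum>k\<in>K. \<bar>f k\<bar>) + (\<Sum>k\<in>K. \<bar>g k\<bar>)"
    unfolding sum.distrib[symmetric] by (intro sum_mono) simp
  also have "\<dots> \<le> a + b"
    using assms K by (auto simp: l1_le_def intro!: add_mono)
  finally show "(\<Sum>k\<in>K. \<bar>f k + g k\<bar>) \<le> a + b" .
qed

lemma l1_le_cmult: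
  assumes "l1_le f a"
  shows "l1_le (\<lambda>k. x * f k) (\<bar>x\<bar> * a)"
  unfolding l1_le_def
proof (intro allI impI)
  fix K :: "int set" assume K: "finite K"
  have "(\<Sum>k\<in>K. \<bar>x * f k\<bar>) = \<bar>x\<bar> * (\<Sum>k\<in>K. \<bar>f k\<bar>)"
    by (simp add: abs_mult sum_distrib_left)
  also have "\<dots> \<le> \<bar>x\<bar> * a"
    using assms K by (auto simp: l1_le_def intro!: mult_left_mono)
  finally show "(\<Sum>k\<in>K. \<bar>x * f k\<bar>) \<le> \<bar>x\<bar> * a" .
qed

lemma l1_le_shift:
  assumes "l1_le f a"
  shows "l1_le (\<lambda>k. f (k + d)) a"
  unfolding l1_le_def
proof (intro allI impI)
  fix K :: "int set" assume K: "finite K"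
  have "(\<Sum>k\<in>K. \<bar>f (k + d)\<bar>) = (\<Sum>k\<in>(\<lambda>k. k + d) ` K. \<bar>f k\<bar>)"
    by (subst sum.reindex) (auto simp: inj_on_def)
  also have "\<dots> \<le> a"
    using assms K by (auto simp: l1_le_def)
  finally show "(\<Sum>k\<in>K. \<bar>f (k + d)\<bar>) \<le> a" .
qed

definition l1_null :: "(nat \<Rightarrow> int \<Rightarrow> real) \<Rightarrow> bool"
  where "l1_null F \<longleftrightarrow> (\<forall>e>0. \<forall>\<^sub>F n in sequentially. l1_le (F n) e)"

lemma l1_null_zero: "l1_null (\<lambda>n k. 0)"
  unfolding l1_null_def using l1_le_mono[OF l1_le_zero] by auto

lemma l1_null_add:
  assumes "l1_null F" "l1_null G"
  shows "l1_null (\<lambda>n k. F n k + G n k)"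
  unfolding l1_null_def
proof (intro allI impI)
  fix e :: real assume e: "e > 0"
  have "\<forall>\<^sub>F n in sequentially. l1_le (F n) (e / 2)" "\<forall>\<^sub>F n in sequentially. l1_le (G n) (e / 2)"
    using assms e by (simp_all add: l1_null_def)
  then show "\<forall>\<^sub>F n in sequentially. l1_le (\<lambda>k. F n k + G n k) e"
    by eventually_elim (use l1_le_add in fastforce)
qed

lemma l1_null_cmult:
  assumes "l1_null F"
  shows "l1_null (\<lambda>n k. x * F n k)"
  unfolding l1_null_def
proof (intro allI impI)
  fix e :: real assume e: "e > 0"
  have "\<forall>\<^sub>F n in sequentially. l1_le (F n) (e / (\<bar>x\<bar> + 1))"
    using assms e by (simp add: l1_null_def)
  then show "\<forall>\<^sub>F n in sequentially. l1_le (\<lambda>k. x * F n k) e"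
  proof eventually_elim
    case (elim n)
    have "\<bar>x\<bar> * (e / (\<bar>x\<bar> + 1)) \<le> e"
      using e by (simp add: field_simps)
    with l1_le_cmult[OF elim] show ?case
      by (rule l1_le_mono)
  qed
qed

lemma l1_null_shift:
  assumes "l1_null F"
  shows "l1_null (\<lambda>n k. F n (k + d))"
  unfolding l1_null_def
proof (intro allI impI)
  fix e :: real assume "e > 0"
  with assms have "\<forall>\<^sub>F n in sequentially. l1_le (F n) e"
    by (simp add: l1_null_def)
  then show "\<forall>\<^sub>F n in sequentially. l1_le (\<lambda>k. F n (k + d)) e"
    by eventually_elim (rule l1_le_shift)
qed

lemma l1_null_sum:
  assumes "finite S" "\<And>i. i \<in> S \<Longrightarrow> l1_null (F i)"
  shows "l1_null (\<lambda>n k. \<Sum>i\<in>S. F i n k)"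
  using assms by (induction S) (auto simp: l1_null_zero l1_null_add)

text \<open>A translate by a fixed \<open>d\<close> telescopes into \<open>|d|\<close> unit
  translates; negative \<open>d\<close> reduces to positive \<open>d\<close> by a shift and a change
  of sign.\<close>

lemma l1_null_translates:
  fixes q :: "nat \<Rightarrow> int \<Rightarrow> real"
  assumes "l1_null (\<lambda>n k. q n k - q n (k - 1))"
  shows "l1_null (\<lambda>n k. q n (k + a) - q n (k + b))"
proof -
  have nat: "l1_null (\<lambda>n k. q n k - q n (k - int d))" for d
  proof (induction d)
    case 0
    then show ?case by (simp add: l1_null_zero)
  next
    case (Suc d)
    from l1_null_add[OF Suc l1_null_shift[OF assms, of "- int d"]]
    show ?case by (simp add: algebra_simps)
  qed
  have "l1_null (\<lambda>n k. q n k - q n (k - d))" for d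
  proof (cases "d \<ge> 0")
    case True
    then show ?thesis using nat[of "nat d"] by simp
  next
    case False
    then show ?thesis
      using l1_null_cmult[OF l1_null_shift[OF nat[of "nat (-d)"], of "-d"], of "-1"] by simp
  qed
  from l1_null_shift[OF this[of "a - b"], of a] show ?thesis
    by (simp add: algebra_simps)
qed

section \<open>Smoothness of the symmetric binomial law under unit translation\<close>

lemma sum_binomial_second_moment:
  "(\<Sum>k\<le>n. real (n choose k) * (real n - 2 * real k)\<^sup>2) = real n * 2 ^ n"
proof -
  have 1: "(\<Sum>k\<le>n. real (n choose k)) = 2 ^ n"
    using choose_row_sum[of n] by (metis of_nat_numeral of_nat_power of_nat_sum)
  \<comment> \<open>Bernstein polynomials at 1/2 are the fair-coin weights, so their known factorial
    moments give the variance \<open>n\<close> of a sum of \<open>n\<close> fair signs, here scaled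
    by \<open>2 ^ n\<close>.\<close>
  have B: "Bernstein n k (1/2) = real (n choose k) / 2 ^ n" if "k \<le> n" for k
  proof -
    have "(1/2::real) ^ k * (1/2) ^ (n - k) = (1/2) ^ n"
      using that by (simp flip: power_add)
    then show ?thesis
      by (simp add: Bernstein_def power_one_over field_simps)
  qed
  have 2: "(\<Sum>k\<le>n. real (n choose k) * real k) = 2 ^ n * (real n / 2)"
  proof -
    have "(\<Sum>k\<le>n. real (n choose k) * real k) = 2 ^ n * (\<Sum>k\<le>n. real k * Bernstein n k (1/2))"
      unfolding sum_distrib_left by (intro sum.cong) (auto simp: B)
    then show ?thesis by (simp add: sum_k_Bernstein)
  qed
  have 3: "(\<Sum>k\<le>n. real (n choose k) * (real k * (real k - 1))) = 2 ^ n * (real n * (real n - 1) / 4)"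
  proof -
    have "(\<Sum>k\<le>n. real (n choose k) * (real k * (real k - 1)))
        = 2 ^ n * (\<Sum>k\<le>n. real k * (real k - 1) * Bernstein n k (1/2))"
      unfolding sum_distrib_left by (intro sum.cong) (auto simp: B)
    then show ?thesis by (simp add: sum_kk_Bernstein power2_eq_square)
  qed
  have "(\<Sum>k\<le>n. real (n choose k) * (real n - 2 * real k)\<^sup>2)
      = (\<Sum>k\<le>n. (real n)\<^sup>2 * real (n choose k) + (4 - 4 * real n) * (real (n choose k) * real k)
          + 4 * (real (n choose k) * (real k * (real k - 1))))"
    by (intro sum.cong) (auto simp: algebra_simps power2_eq_square)
  also have "\<dots> = (real n)\<^sup>2 * 2 ^ n + (4 - 4 * real n) * (2 ^ n * (real n / 2))
      + 4 * (2 ^ n * (real n * (real n - 1) / 4))"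
    by (simp only: sum.distrib sum_distrib_left[symmetric] 1 2 3)
  also have "\<dots> = real n * 2 ^ n"
    by (simp add: field_simps power2_eq_square)
  finally show ?thesis .
qed

text \<open>The law of the number of heads in \<open>j\<close> fair tosses, as a function on all
  integers so that it can be translated freely. The case split is needed because
  \<open>nat k\<close> is 0 for negative \<open>k\<close>.\<close>

definition half_binomial :: "nat \<Rightarrow> int \<Rightarrow> real"
  where "half_binomial j k = (if k < 0 then 0 else real (j choose nat k) / 2 ^ j)"

lemma half_binomial_Suc:
  "half_binomial (Suc j) k = (half_binomial j k + half_binomial j (k - 1)) / 2"
proof (cases "k \<le> 0")
  case True
  then show ?thesis by (cases "k = 0") (auto simp: half_binomial_def)
next
  case False
  define i where "i = nat (k - 1)"
  have "k = int (Suc i)" using False by (simp add: i_def)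
  then show ?thesis
    by (simp add: half_binomial_def nat_add_distrib field_simps)
qed

text \<open>Absorption and Pascal's rule rewrite the difference through row \<open>Suc j\<close>,
  whose range is exactly the support of the difference. What appears is a centred deviation, so a
  second moment controls it.\<close>

lemma half_binomial_difference:
  assumes "k \<ge> 0"
  shows "half_binomial j k - half_binomial j (k - 1)
    = real (Suc j choose nat k) * (real (Suc j) - 2 * real (nat k)) / (real (Suc j) * 2 ^ j)"
proof (cases "nat k")
  case 0
  then show ?thesis using assms by (simp add: half_binomial_def)
next
  case (Suc i)
  then have k: "k = int (Suc i)" by simp
  have 1: "real (Suc i) * real (Suc j choose Suc i) = real (Suc j) * real (j choose i)"
    using Suc_times_binomial[of i j] by (metis of_nat_mult)
  have 2: "real (Suc j choose Suc i) = real (j choose i) + real (j choose Suc i)"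
    by simp
  have "real (Suc j) * (real (j choose Suc i) - real (j choose i))
      = real (Suc j) * real (Suc j choose Suc i) - 2 * (real (Suc j) * real (j choose i))"
    unfolding 2 by (simp only: algebra_simps)
  also have "\<dots> = real (Suc j choose Suc i) * (real (Suc j) - 2 * real (Suc i))"
    unfolding 1[symmetric] by (simp only: algebra_simps)
  finally have "real (j choose Suc i) - real (j choose i)
      = real (Suc j choose Suc i) * (real (Suc j) - 2 * real (Suc i)) / real (Suc j)"
    by (simp add: field_simps)
  then show ?thesis
    by (simp add: half_binomial_def k nat_add_distrib flip: diff_divide_distrib del: binomial_Suc_Suc)
qed

text \<open>By the preceding identity the l^1 norm is a mean absolute deviation, which is at most
  the standard deviation.\<close>

lemma l1_le_half_binomial_difference:
  "l1_le (\<lambda>k. half_binomial j k - half_binomial j (k - 1)) (2 / sqrt (real (Suc j)))"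
  unfolding l1_le_def
proof (intro allI impI)
  fix K :: "int set" assume K: "finite K"
  let ?f = "\<lambda>k. \<bar>half_binomial j k - half_binomial j (k - 1)\<bar>"
  define J where "J = Suc j"
  define t where "t = sqrt (real J)"
  have t: "t > 0" "t\<^sup>2 = real J" by (simp_all add: t_def J_def)
  have "(\<Sum>k\<in>K. ?f k) \<le> (\<Sum>k\<in>K \<union> int ` {..J}. ?f k)"
    using K by (intro sum_mono2) auto
  also have "\<dots> = (\<Sum>k\<in>int ` {..J}. ?f k)"
  proof (rule sum.mono_neutral_right)
    show "\<forall>k\<in>(K \<union> int ` {..J}) - int ` {..J}. ?f k = 0"
    proof
      fix k assume "k \<in> (K \<union> int ` {..J}) - int ` {..J}"
      then have k: "k \<notin> int ` {..J}" by auto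
      show "?f k = 0"
      proof (cases "k < 0")
        case False
        then have "nat k > J"
          using k by (metis atMost_iff image_eqI int_nat_eq linorder_not_less)
        then show ?thesis
          using half_binomial_difference[of k j] False by (simp add: J_def binomial_eq_0)
      qed (simp add: half_binomial_def)
    qed
  qed (use K in auto)
  also have "\<dots> = (\<Sum>k\<le>J. ?f (int k))"
    by (subst sum.reindex) auto
  also have "\<dots> = (\<Sum>k\<le>J. real (J choose k) * \<bar>real J - 2 * real k\<bar> / (real J * 2 ^ j))"
    by (intro sum.cong refl) (simp add: half_binomial_difference J_def abs_mult del: of_nat_Suc binomial_Suc_Suc)
  also have "\<dots> = (\<Sum>k\<le>J. real (J choose k) * \<bar>real J - 2 * real k\<bar>) / (real J * 2 ^ j)"
    by (simp add: sum_divide_distrib)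
  \<comment> \<open>The arithmetic-geometric mean inequality replaces Cauchy-Schwarz; with
    \<open>t = sqrt J\<close> the quadratic and the constant term contribute equally.\<close>
  also have "(\<Sum>k\<le>J. real (J choose k) * \<bar>real J - 2 * real k\<bar>)
      \<le> (\<Sum>k\<le>J. real (J choose k) * (((real J - 2 * real k)\<^sup>2 / t + t) / 2))"
  proof (intro sum_mono mult_left_mono)
    fix k
    define x where "x = \<bar>real J - 2 * real k\<bar>"
    have "0 \<le> (x - t)\<^sup>2" by simp
    then have "2 * t * x \<le> x\<^sup>2 + t\<^sup>2" by (simp add: power2_diff mult.commute mult.left_commute)
    then have "x \<le> (x\<^sup>2 / t + t) / 2" using t(1) by (simp add: field_simps power2_eq_square)
    then show "\<bar>real J - 2 * real k\<bar> \<le> ((real J - 2 * real k)\<^sup>2 / t + t) / 2"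
      by (simp add: x_def)
  qed auto
  also have "\<dots> = (\<Sum>k\<le>J. (1 / (2 * t)) * (real (J choose k) * (real J - 2 * real k)\<^sup>2)
      + (t / 2) * real (J choose k))"
    by (intro sum.cong) (auto simp: field_simps)
  also have "\<dots> = (1 / (2 * t)) * (real J * 2 ^ J) + (t / 2) * 2 ^ J"
  proof -
    have "(\<Sum>k\<le>J. real (J choose k)) = 2 ^ J"
      using choose_row_sum[of J] by (metis of_nat_numeral of_nat_power of_nat_sum)
    then show ?thesis
      by (simp only: sum.distrib sum_distrib_left[symmetric] sum_binomial_second_moment)
  qed
  also have "\<dots> = t * 2 ^ J"
    unfolding t(2)[symmetric] using t(1) by (simp add: field_simps power2_eq_square)
  also have "t * 2 ^ J / (real J * 2 ^ j) = 2 / t"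
    unfolding t(2)[symmetric] using t(1) by (simp add: J_def field_simps power2_eq_square)
  finally show "(\<Sum>k\<in>K. ?f k) \<le> 2 / sqrt (real (Suc j))"
    by (simp add: t_def J_def divide_right_mono)
qed

text \<open>The law of the difference of two independent uniform choices from \<open>{0, a, 2 * a + 1}\<close>,
  convolved with \<open>f\<close>.\<close>

definition conv_step :: "nat \<Rightarrow> (int \<Rightarrow> real) \<Rightarrow> int \<Rightarrow> real"
  where "conv_step a f k = (\<Sum>x\<leftarrow>[0, int a, 2 * int a + 1]. \<Sum>y\<leftarrow>[0, int a, 2 * int a + 1]. f (k - x + y)) / 9"

text \<open>The law of \<open>j\<close> fair tosses convolved with the first \<open>n\<close>
  digit-difference laws. Overlaps only involve \<open>j = 0\<close>; general \<open>j\<close> lets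
  the induction collect the coins split off from the digits.\<close>

primrec smooth :: "(nat \<Rightarrow> nat) \<Rightarrow> nat \<Rightarrow> nat \<Rightarrow> int \<Rightarrow> real"
  where "smooth h 0 j = half_binomial j"
  | "smooth h (Suc n) j = conv_step (h n) (smooth h n j)"

text \<open>Convolution with a digit law is linear and commutes with translations, so an extra coin
  passes through all of them.\<close>

lemma smooth_Suc2: "smooth h n (Suc j) k = (smooth h n j k + smooth h n j (k - 1)) / 2"
proof (induction n arbitrary: k)
  case 0
  then show ?case by (simp add: half_binomial_Suc)
next
  case (Suc n)
  show ?case
    by (simp add: conv_step_def Suc.IH algebra_simps add_divide_distrib)
qed

text \<open>The choices \<open>a\<close> and \<open>a + 1\<close> for the difference, as well as \<open>- a\<close> and \<open>- a - 1\<close>, amount to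
  one more fair coin toss, which is what increases \<open>j\<close>.\<close>

lemma smooth_Suc_eq:
  "smooth h (Suc n) j k =
    1/9 * (3 * smooth h n j k + smooth h n j (k - 2 * int (h n) - 1) + smooth h n j (k + 2 * int (h n) + 1))
    + 2/9 * (smooth h n (Suc j) (k - int (h n)) + smooth h n (Suc j) (k + int (h n) + 1))"
  unfolding smooth_Suc2 by (simp add: conv_step_def algebra_simps add_divide_distrib)

text \<open>The bound \<open>b j n = e + M / 2 ^ j * (7/9) ^ n\<close> solves the recursion
  \<open>b j (Suc n) = 5/9 * b j n + 4/9 * b (Suc j) n\<close> coming from the previous lemma.\<close>

lemma l1_le_smooth_difference:
  assumes "\<And>j. 2 / sqrt (real (Suc j)) \<le> e + M / 2 ^ j"
  shows "l1_le (\<lambda>k. smooth h n j k - smooth h n j (k - 1)) (e + M / 2 ^ j * (7/9) ^ n)"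
proof (induction n arbitrary: j)
  case 0
  then show ?case
    using l1_le_mono[OF l1_le_half_binomial_difference assms] by simp
next
  case (Suc n)
  define d where "d j k = smooth h n j k - smooth h n j (k - 1)" for j k
  have d: "l1_le (\<lambda>k. d j (k + x)) (e + M / 2 ^ j * (7/9) ^ n)" for j x
    using l1_le_shift[OF Suc.IH] by (simp add: d_def)
  have eq: "smooth h (Suc n) j k - smooth h (Suc n) j (k - 1) =
     ((1/3 * d j (k + 0) + 1/9 * d j (k + (- 2 * int (h n) - 1))) + 1/9 * d j (k + (2 * int (h n) + 1)))
     + (2/9 * d (Suc j) (k + (- int (h n))) + 2/9 * d (Suc j) (k + (int (h n) + 1)))" for k
    unfolding smooth_Suc_eq d_def by (simp add: algebra_simps)
  have "l1_le (\<lambda>k. smooth h (Suc n) j k - smooth h (Suc n) j (k - 1))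
    (((\<bar>1/3\<bar> * (e + M / 2 ^ j * (7/9) ^ n) + \<bar>1/9\<bar> * (e + M / 2 ^ j * (7/9) ^ n)) + \<bar>1/9\<bar> * (e + M / 2 ^ j * (7/9) ^ n))
     + (\<bar>2/9\<bar> * (e + M / 2 ^ Suc j * (7/9) ^ n) + \<bar>2/9\<bar> * (e + M / 2 ^ Suc j * (7/9) ^ n)))"
    unfolding eq by (intro l1_le_add l1_le_cmult d)
  \<comment> \<open>The weights sum to 5/9 at \<open>j\<close> and 4/9 at \<open>Suc j\<close>,
    where the \<open>M\<close> term is halved: 5/9 + (4/9)/2 = 7/9.\<close>
  then show ?case
    by (rule l1_le_mono) (simp add: field_simps)
qed

lemma l1_null_smooth_difference: "l1_null (\<lambda>n k. smooth h n 0 k - smooth h n 0 (k - 1))"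
  unfolding l1_null_def
proof (intro allI impI)
  fix e :: real assume e: "e > 0"
  have "(\<lambda>j. 2 / sqrt (real (Suc j))) \<longlonglongrightarrow> 0"
    by real_asymp
  then have "\<forall>\<^sub>F j in sequentially. 2 / sqrt (real (Suc j)) < e / 2"
    using e by (intro order_tendstoD) auto
  then obtain J where J: "\<And>j. j \<ge> J \<Longrightarrow> 2 / sqrt (real (Suc j)) < e / 2"
    by (auto simp: eventually_sequentially)
  \<comment> \<open>For \<open>j < J\<close> the term \<open>M / 2 ^ j\<close> exceeds the trivial
    bound 2; for \<open>j >= J\<close> the term \<open>e / 2\<close> suffices.\<close>
  define M :: real where "M = 2 * 2 ^ J"
  have "2 / sqrt (real (Suc j)) \<le> e / 2 + M / 2 ^ j" for j
  proof (cases "j \<ge> J")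
    case True
    have "M / 2 ^ j \<ge> 0" by (simp add: M_def)
    then show ?thesis using J[OF True] by linarith
  next
    case False
    have "2 / sqrt (real (Suc j)) \<le> 2"
      by (simp add: divide_le_eq)
    also have "2 \<le> M / 2 ^ j"
      using False by (simp add: M_def field_simps power_increasing)
    finally show ?thesis using e by simp
  qed
  then have *: "l1_le (\<lambda>k. smooth h n 0 k - smooth h n 0 (k - 1)) (e / 2 + M * (7/9) ^ n)" for n
    using l1_le_smooth_difference[of "e / 2" M h n 0] by simp
  have "(\<lambda>n. M * (7/9) ^ n) \<longlonglongrightarrow> 0"
    by real_asymp
  then have "\<forall>\<^sub>F n in sequentially. M * (7/9) ^ n < e / 2"
    using e by (intro order_tendstoD) auto
  then show "\<forall>\<^sub>F n in sequentially. l1_le (\<lambda>k. smooth h n 0 k - smooth h n 0 (k - 1)) e"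
    by eventually_elim (rule l1_le_mono[OF *], simp)
qed

section \<open>Levels inside the unit interval\<close>

text \<open>Since \<open>T\<close> is arbitrary at discarded cut points, even measurability of an
  image has to be obtained by correcting a Borel set in finitely many points.\<close>

lemma lborel_almost_equal:
  assumes "Y \<in> sets borel" "Y \<subseteq> X" "X \<subseteq> Y \<union> Z" "finite (Z :: real set)"
  shows "X \<in> sets borel" "measure lborel X = measure lborel Y"
proof -
  have X: "X = Y \<union> (X \<inter> Z)" using assms by auto
  have fin: "finite (X \<inter> Z)" using assms by simp
  then have "X \<inter> Z \<in> sets borel" using finite_imp_closed borel_closed by blast
  with assms(1) have "Y \<union> (X \<inter> Z) \<in> sets borel" by (rule sets.Un)
  then show "X \<in> sets borel" by (simp only: flip: X)
  have "measure lborel (Y \<union> (X \<inter> Z)) = measure lborel Y"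
    using assms(1) by (intro measure_Un_null_set finite_imp_null_set_lborel fin) auto
  then show "measure lborel X = measure lborel Y"
    by (simp only: flip: X)
qed

lemma translation_borel:
  fixes S :: "real set"
  assumes "S \<in> sets borel"
  shows "(\<lambda>x. x + d) ` S \<in> sets borel"
proof -
  have "(\<lambda>x. x + d) ` S = (\<lambda>x. x - d) -` S"
  proof (intro equalityI subsetI)
    fix y assume "y \<in> (\<lambda>x. x - d) -` S"
    then have "y - d \<in> S" by simp
    then show "y \<in> (\<lambda>x. x + d) ` S" by (rule rev_image_eqI) simp
  qed auto
  also have "\<dots> \<in> sets borel"
    using assms by (intro measurable_sets_borel[of _ borel]) auto
  finally show ?thesis .
qed

lemma measure_lborel_translation:
  fixes S :: "real set"
  assumes "S \<in> sets borel"
  shows "measure lborel ((\<lambda>x. x + d) ` S) = measure lborel S"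
proof -
  have "(\<lambda>x. x + d) ` S = (+) d ` S" by (auto simp: add.commute)
  then show ?thesis
    using measure_translation[of d S] assms translation_borel[OF assms, of d]
    by (simp add: measure_completion)
qed

lemma fmeasurable_lborel_unit:
  "A \<in> sets borel \<Longrightarrow> A \<subseteq> {0<..<1::real} \<Longrightarrow> A \<in> fmeasurable lborel"
  by (rule fmeasurableI2[of "{0<..<1}"]) (auto intro!: fmeasurableI)

text \<open>The part of the construction that the argument uses: \<open>h n\<close> and
  \<open>l n i\<close> are the height and left endpoints of the \<open>n\<close>-th column. The
  middle spacer shows in the offset \<open>2 * h n + 1\<close>, the top spacers only in the growth
  bound \<open>h_Suc\<close>.\<close>

locale tower =
  fixes h :: "nat \<Rightarrow> nat" and l :: "nat \<Rightarrow> nat \<Rightarrow> real" and T :: "real \<Rightarrow> real"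
  assumes h_0: "h 0 = 1"
    and h_Suc: "9 * h n \<le> h (Suc n)"
    and l_0: "l 0 0 = 0"
    and l_left: "i < h n \<Longrightarrow> l (Suc n) i = l n i"
    and l_middle: "i < h n \<Longrightarrow> l (Suc n) (i + h n) = l n i + 1 / 3 ^ Suc n"
    and l_right: "i < h n \<Longrightarrow> l (Suc n) (i + (2 * h n + 1)) = l n i + 2 / 3 ^ Suc n"
    and disjoint_levels: "disjoint_family_on (\<lambda>i. {l n i <..< l n i + 1 / 3 ^ n}) {..<h n}"
    and T_level: "Suc i < h n \<Longrightarrow> x \<in> {l n i <..< l n i + 1 / 3 ^ n}
      \<Longrightarrow> T x = x - l n i + l n (Suc i)"
begin

definition lev :: "nat \<Rightarrow> nat \<Rightarrow> real set"
  where "lev n i = {l n i <..< l n i + 1 / 3 ^ n}"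

definition levs :: "nat \<Rightarrow> nat set \<Rightarrow> real set"
  where "levs n S = (\<Union>i\<in>S. lev n i)"

text \<open>\<open>copies n S\<close> lists the positions in the next column of the three copies of the levels in \<open>S\<close>;
  the shift \<open>2 * h n + 1\<close> includes the spacer above the middle subcolumn.\<close>

definition copies :: "nat \<Rightarrow> nat set \<Rightarrow> nat set"
  where "copies n S = S \<union> (\<lambda>i. i + h n) ` S \<union> (\<lambda>i. i + (2 * h n + 1)) ` S"

primrec desc :: "nat \<Rightarrow> nat set \<Rightarrow> nat \<Rightarrow> nat set"
  where "desc m S 0 = S"
  | "desc m S (Suc p) = copies (m + p) (desc m S p)"

text \<open>These are the positions of the levels of column \<open>n\<close> inside the unit
  interval, that is, the digit sums.\<close>

definition base :: "nat \<Rightarrow> nat set"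
  where "base n = desc 0 {0} n"

definition overlap :: "nat \<Rightarrow> real set \<Rightarrow> real set \<Rightarrow> real"
  where "overlap k A B = measure lborel (A \<inter> (T ^^ k) ` B)"

section \<open>Positions of levels and their refinement\<close>

lemma h_pos: "h n > 0"
proof (induction n)
  case (Suc n)
  then show ?case using h_Suc[of n] by linarith
qed (simp add: h_0)

lemma h_mono: "m \<le> n \<Longrightarrow> h m \<le> h n"
proof (rule lift_Suc_mono_le[of h])
  show "h n \<le> h (Suc n)" for n using h_Suc[of n] by linarith
qed

lemma h_strict_mono: "strict_mono h"
proof (rule strict_monoI_Suc)
  show "h n < h (Suc n)" for n using h_Suc[of n] h_pos[of n] by linarith
qed

lemma copies_less: "S \<subseteq> {..<h n} \<Longrightarrow> i \<in> copies n S \<Longrightarrow> i < 3 * h n + 1"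
  by (auto simp: copies_def)

lemma copies_subset: "S \<subseteq> {..<h n} \<Longrightarrow> copies n S \<subseteq> {..<h (Suc n)}"
  using copies_less[of S n] h_Suc[of n] h_pos[of n] by fastforce

lemma copies_mono: "S \<subseteq> R \<Longrightarrow> copies n S \<subseteq> copies n R"
  by (auto simp: copies_def)

lemma sum_copies:
  assumes "S \<subseteq> {..<h n}"
  shows "sum f (copies n S) = (\<Sum>i\<in>S. f i) + (\<Sum>i\<in>S. f (i + h n)) + (\<Sum>i\<in>S. f (i + (2 * h n + 1)))"
proof -
  have fin: "finite S" using assms finite_subset by blast
  have "sum f (copies n S) = sum f (S \<union> (\<lambda>i. i + h n) ` S) + sum f ((\<lambda>i. i + (2 * h n + 1)) ` S)"
    unfolding copies_def
  proof (rule sum.union_disjoint)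
    show "(S \<union> (\<lambda>i. i + h n) ` S) \<inter> (\<lambda>i. i + (2 * h n + 1)) ` S = {}"
      using assms by fastforce
  qed (use fin in auto)
  also have "sum f (S \<union> (\<lambda>i. i + h n) ` S) = sum f S + sum f ((\<lambda>i. i + h n) ` S)"
  proof (rule sum.union_disjoint)
    show "S \<inter> (\<lambda>i. i + h n) ` S = {}"
      using assms by fastforce
  qed (use fin in auto)
  finally show ?thesis
    by (simp add: sum.reindex inj_on_def)
qed

lemma desc_subset: "S \<subseteq> {..<h m} \<Longrightarrow> desc m S p \<subseteq> {..<h (m + p)}"
  by (induction p) (auto dest!: copies_subset)

lemma desc_mono: "S \<subseteq> R \<Longrightarrow> desc m S p \<subseteq> desc m R p"
  by (induction p) (auto intro!: copies_mono)

lemma desc_base: "desc m (base m) p = base (m + p)"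
  by (induction p) (auto simp: base_def)

lemma base_0: "base 0 = {0}"
  by (simp add: base_def)

lemma base_Suc: "base (Suc n) = copies n (base n)"
  by (simp add: base_def)

lemma base_subset: "base n \<subseteq> {..<h n}"
  using desc_subset[of "{0}" 0 n] by (simp add: base_def h_0)

lemma base_less: "i \<in> base n \<Longrightarrow> i < h n"
  using base_subset by auto

lemma finite_base: "finite (base n)"
  using base_subset finite_subset by blast

text \<open>Levels inside the unit interval end below \<open>3 * h n + 1\<close>, while the column
  has height at least \<open>9 * h n\<close>. Up to time \<open>h n\<close> they therefore stay
  within the column; this is where the tall top spacers matter.\<close>

lemma base_add_less:
  assumes "i \<in> base (Suc n)" "k < h n"
  shows "i + k < h (Suc n)"
  using copies_less[OF base_subset[of n], of i] h_Suc[of n] assms by (simp add: base_Suc)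

lemma card_base: "card (base n) = 3 ^ n"
  by (induction n) (use sum_copies[OF base_subset, where f="\<lambda>_. 1 :: nat"] in \<open>auto simp: base_0 base_Suc\<close>)

lemma lev_disjoint: "i < h n \<Longrightarrow> j < h n \<Longrightarrow> x \<in> lev n i \<Longrightarrow> x \<in> lev n j \<Longrightarrow> i = j"
  using disjoint_levels[of n] unfolding disjoint_family_on_def lev_def by blast

lemma lev_borel [measurable]: "lev n i \<in> sets borel"
  by (simp add: lev_def)

lemma measure_lev: "measure lborel (lev n i) = 1 / 3 ^ n"
  by (simp add: lev_def)

lemma levs_borel: "finite S \<Longrightarrow> levs n S \<in> sets borel"
  unfolding levs_def by (intro sets.finite_UN) auto

lemma lev_fmeasurable: "lev n i \<in> fmeasurable lborel"
  unfolding lev_def by (intro fmeasurableI) auto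

lemma measure_levs:
  assumes "S \<subseteq> {..<h n}"
  shows "measure lborel (levs n S) = real (card S) / 3 ^ n"
proof -
  have "measure lborel (levs n S) = (\<Sum>i\<in>S. measure lborel (lev n i))"
    unfolding levs_def
  proof (rule measure_UNION')
    show "finite S" using assms finite_subset by blast
    show "pairwise (\<lambda>i j. disjnt (lev n i) (lev n j)) S"
      using assms lev_disjoint unfolding pairwise_def disjnt_iff by (meson lessThan_iff subsetD)
  qed (simp add: lev_fmeasurable)
  then show ?thesis by (simp add: measure_lev)
qed

text \<open>Cutting a level into three open thirds loses just the two cut points.\<close>

lemma levs_copies:
  assumes "S \<subseteq> {..<h n}"
  shows "levs (Suc n) (copies n S) \<subseteq> levs n S"
    and "finite (levs n S - levs (Suc n) (copies n S))"
proof -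
  define w :: real where "w = 1 / 3 ^ Suc n"
  have w: "w > 0" "1 / 3 ^ n = 3 * w" by (simp_all add: w_def)
  have lev: "lev n i = {l n i <..< l n i + 3 * w}" for i
    by (simp add: lev_def w)
  have sub: "lev (Suc n) i = {l n i <..< l n i + w}"
      "lev (Suc n) (i + h n) = {l n i + w <..< l n i + 2 * w}"
      "lev (Suc n) (i + (2 * h n + 1)) = {l n i + 2 * w <..< l n i + 3 * w}" if "i \<in> S" for i
  proof -
    have "i < h n" using that assms by auto
    then have "l (Suc n) i = l n i" "l (Suc n) (i + h n) = l n i + w"
      "l (Suc n) (i + (2 * h n + 1)) = l n i + 2 * w"
      using l_left[of i n] l_middle[of i n] l_right[of i n] by (simp_all add: w_def)
    moreover have "lev (Suc n) j = {l (Suc n) j <..< l (Suc n) j + w}" for j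
      by (simp add: lev_def w_def)
    ultimately show "lev (Suc n) i = {l n i <..< l n i + w}"
      "lev (Suc n) (i + h n) = {l n i + w <..< l n i + 2 * w}"
      "lev (Suc n) (i + (2 * h n + 1)) = {l n i + 2 * w <..< l n i + 3 * w}"
      by (simp_all add: algebra_simps)
  qed
  have eq: "levs (Suc n) (copies n S) = (\<Union>i\<in>S. lev (Suc n) i \<union> lev (Suc n) (i + h n)
      \<union> lev (Suc n) (i + (2 * h n + 1)))"
    by (auto simp: levs_def copies_def)
  show "levs (Suc n) (copies n S) \<subseteq> levs n S"
  proof
    fix x assume "x \<in> levs (Suc n) (copies n S)"
    then obtain i where i: "i \<in> S"
      "x \<in> lev (Suc n) i \<union> lev (Suc n) (i + h n) \<union> lev (Suc n) (i + (2 * h n + 1))"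
      unfolding eq by blast
    then have "x \<in> lev n i" unfolding sub[OF i(1)] lev using w(1) by auto
    with i(1) show "x \<in> levs n S" by (auto simp: levs_def)
  qed
  have "levs n S - levs (Suc n) (copies n S) \<subseteq> (\<Union>i\<in>S. {l n i + w, l n i + 2 * w})"
  proof
    fix x assume x: "x \<in> levs n S - levs (Suc n) (copies n S)"
    then obtain i where i: "i \<in> S" "x \<in> lev n i" by (auto simp: levs_def)
    then have "x \<notin> lev (Suc n) i \<union> lev (Suc n) (i + h n) \<union> lev (Suc n) (i + (2 * h n + 1))"
      using x unfolding eq by blast
    then have "x = l n i + w \<or> x = l n i + 2 * w"
      using i(2) unfolding sub[OF i(1)] lev by auto
    with i(1) show "x \<in> (\<Union>i\<in>S. {l n i + w, l n i + 2 * w})" by auto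
  qed
  moreover have "finite S" using assms finite_subset by blast
  ultimately show "finite (levs n S - levs (Suc n) (copies n S))"
    using finite_subset by blast
qed

lemma levs_desc:
  assumes "S \<subseteq> {..<h m}"
  shows "levs (m + p) (desc m S p) \<subseteq> levs m S \<and> finite (levs m S - levs (m + p) (desc m S p))"
proof (induction p)
  case (Suc p)
  note c = levs_copies[OF desc_subset[OF assms, of p]]
  let ?A = "levs m S" and ?B = "levs (m + p) (desc m S p)"
    and ?C = "levs (Suc (m + p)) (copies (m + p) (desc m S p))"
  have "finite ((?A - ?B) \<union> (?B - ?C))" using Suc c(2) by simp
  then have "finite (?A - ?C)" by (rule rev_finite_subset) auto
  moreover have "?C \<subseteq> ?A" using Suc c(1) by blast
  ultimately show ?case by simp
qed simp

lemma levs_0: "levs 0 {0} = {0<..<1}"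
  by (simp add: levs_def lev_def l_0)

lemma levs_base: "levs n (base n) \<subseteq> {0<..<1}" "finite ({0<..<1} - levs n (base n))"
  using levs_desc[of "{0}" 0 n] by (simp_all add: levs_0 h_0 base_def)

lemma levs_unit: "S \<subseteq> base n \<Longrightarrow> levs n S \<subseteq> {0<..<1}"
  using levs_base(1)[of n] by (auto simp: levs_def)

section \<open>Powers of the transformation as translations between levels\<close>

lemma T_funpow:
  assumes "i + k < h n" "x \<in> lev n i"
  shows "(T ^^ k) x = x + (l n (i + k) - l n i)"
  using assms
proof (induction k)
  case (Suc k)
  have "T (x + (l n (i + k) - l n i)) = x + (l n (i + k) - l n i) - l n (i + k) + l n (Suc (i + k))"
    using Suc.prems by (intro T_level) (auto simp: lev_def)
  then show ?case using Suc by simp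
qed simp

text \<open>Here \<open>T ^^ k\<close> is replaced by the translation of level \<open>i\<close> onto
  level \<open>i + k\<close>, so that measurability and measure follow from translation
  invariance.\<close>

definition piece :: "nat \<Rightarrow> nat \<Rightarrow> real set \<Rightarrow> real set \<Rightarrow> nat \<Rightarrow> real set"
  where "piece n k A B i = A \<inter> (\<lambda>x. x + (l n (i + k) - l n i)) ` (B \<inter> lev n i)"

definition pieces :: "nat \<Rightarrow> nat \<Rightarrow> real set \<Rightarrow> real set \<Rightarrow> real set"
  where "pieces n k A B = (\<Union>i\<in>{i \<in> base n. i + k \<in> base n}. piece n k A B i)"

lemma piece_borel: "A \<in> sets borel \<Longrightarrow> B \<in> sets borel \<Longrightarrow> piece n k A B i \<in> sets borel"
  unfolding piece_def by (intro sets.Int translation_borel) auto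

lemma pieces_borel: "A \<in> sets borel \<Longrightarrow> B \<in> sets borel \<Longrightarrow> pieces n k A B \<in> sets borel"
  unfolding pieces_def by (intro sets.finite_UN piece_borel) (auto simp: finite_base)

lemma pieces_subset: "pieces n k A B \<subseteq> A \<inter> (T ^^ k) ` B"
proof
  fix y assume "y \<in> pieces n k A B"
  then obtain i x where "i + k \<in> base n" "y \<in> A" "x \<in> B" "x \<in> lev n i"
      "y = x + (l n (i + k) - l n i)"
    by (auto simp: pieces_def piece_def)
  then show "y \<in> A \<inter> (T ^^ k) ` B"
    using T_funpow[OF base_less] by (metis IntI image_eqI)
qed

text \<open>The hypothesis on \<open>k\<close> keeps \<open>T ^^ k\<close> a translation on every level in \<open>F\<close>. The discarded cut
  points, where the values of \<open>T\<close> may be arbitrary, only contribute a finite set.\<close>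

lemma overlap_pieces:
  assumes "A \<in> sets borel" "B \<in> sets borel" "A \<subseteq> {0<..<1}" "B \<subseteq> {0<..<1}"
    and "\<And>i. i \<in> base n \<Longrightarrow> i + k < h n"
  shows "A \<inter> (T ^^ k) ` B \<in> sets borel" "overlap k A B = measure lborel (pieces n k A B)"
proof -
  define Z where "Z = {0<..<1} - levs n (base n)"
  have "A \<inter> (T ^^ k) ` B \<subseteq> pieces n k A B \<union> (Z \<union> (T ^^ k) ` Z)"
  proof
    fix y assume "y \<in> A \<inter> (T ^^ k) ` B"
    then obtain x where x: "y \<in> A" "x \<in> B" "y = (T ^^ k) x" by auto
    show "y \<in> pieces n k A B \<union> (Z \<union> (T ^^ k) ` Z)"
    proof (cases "x \<in> Z \<or> y \<in> Z")
      case False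
      then obtain i j where ij: "i \<in> base n" "x \<in> lev n i" "j \<in> base n" "y \<in> lev n j"
        using x assms(3,4) by (auto simp: Z_def levs_def)
      have y: "y = x + (l n (i + k) - l n i)"
        using T_funpow[OF assms(5)[OF ij(1)] ij(2)] x by simp
      then have "y \<in> lev n (i + k)" using ij(2) by (auto simp: lev_def)
      then have "j = i + k"
        using lev_disjoint[of j n "i + k" y] ij assms(5)[OF ij(1)] base_less by blast
      with ij(3) have i: "i \<in> {i \<in> base n. i + k \<in> base n}" using ij(1) by simp
      have "y \<in> (\<lambda>x. x + (l n (i + k) - l n i)) ` (B \<inter> lev n i)"
        by (rule image_eqI[where x = x]) (use x(2) ij(2) y in auto)
      then have "y \<in> piece n k A B i" using x(1) by (simp add: piece_def)
      with i have "y \<in> pieces n k A B" unfolding pieces_def by blast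
      then show ?thesis by simp
    qed (use x in auto)
  qed
  moreover have "finite (Z \<union> (T ^^ k) ` Z)"
    using levs_base(2) by (simp add: Z_def)
  ultimately show "A \<inter> (T ^^ k) ` B \<in> sets borel" "overlap k A B = measure lborel (pieces n k A B)"
    using lborel_almost_equal[OF pieces_borel[OF assms(1,2)] pieces_subset]
    by (simp_all add: overlap_def)
qed

lemma image_borel:
  assumes "A \<in> sets borel" "B \<in> sets borel" "A \<subseteq> {0<..<1}" "B \<subseteq> {0<..<1}"
  shows "A \<inter> (T ^^ k) ` B \<in> sets borel"
proof -
  \<comment> \<open>Hence column \<open>Suc k\<close> is tall enough for time
    \<open>k\<close>.\<close>
  have "k < h k"
  proof (induction k)
    case (Suc k)
    then show ?case using h_Suc[of k] by linarith
  qed (simp add: h_0)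
  then show ?thesis
    using overlap_pieces(1)[OF assms base_add_less] by blast
qed

lemma image_fmeasurable:
  assumes "A \<in> sets borel" "B \<in> sets borel" "A \<subseteq> {0<..<1}" "B \<subseteq> {0<..<1}"
  shows "A \<inter> (T ^^ k) ` B \<in> fmeasurable lborel"
  using image_borel[OF assms] assms(3) by (intro fmeasurable_lborel_unit) auto

lemma pieces_levs:
  assumes "S \<subseteq> base n" "R \<subseteq> base n"
  shows "pieces n k (levs n S) (levs n R) = levs n ((\<lambda>i. i + k) ` {i \<in> R. i + k \<in> S})"
proof -
  have sh: "(\<lambda>x. x + (l n (i + k) - l n i)) ` lev n i = lev n (i + k)" for i
  proof (intro equalityI subsetI)
    fix y assume "y \<in> lev n (i + k)"
    then show "y \<in> (\<lambda>x. x + (l n (i + k) - l n i)) ` lev n i"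
      by (intro rev_image_eqI[of "y - (l n (i + k) - l n i)"]) (auto simp: lev_def)
  qed (auto simp: lev_def)
  have int: "levs n Q \<inter> lev n i = (if i \<in> Q then lev n i else {})"
    if "Q \<subseteq> base n" "i \<in> base n" for Q i
  proof -
    have "levs n Q \<inter> lev n i = {}" if "i \<notin> Q"
      using that \<open>Q \<subseteq> base n\<close> \<open>i \<in> base n\<close> lev_disjoint base_less
      unfolding levs_def by (blast dest: subsetD)
    then show ?thesis by (auto simp: levs_def)
  qed
  have "piece n k (levs n S) (levs n R) i = (if i \<in> R \<and> i + k \<in> S then lev n (i + k) else {})"
    if "i \<in> base n" "i + k \<in> base n" for i
    using int[OF assms(2) that(1)] int[OF assms(1) that(2)] sh[of i]
    by (auto simp: piece_def)
  then show ?thesis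
    using assms unfolding pieces_def levs_def by auto
qed

lemma measure_pieces_levs:
  assumes "S \<subseteq> base n" "R \<subseteq> base n"
  shows "measure lborel (pieces n k (levs n S) (levs n R)) = real (card {i \<in> R. i + k \<in> S}) / 3 ^ n"
  unfolding pieces_levs[OF assms]
  by (subst measure_levs) (use assms base_less[of _ n] in \<open>auto simp: card_image inj_on_def\<close>)

lemma overlap_levs:
  assumes "S \<subseteq> base n" "R \<subseteq> base n" "\<And>i. i \<in> base n \<Longrightarrow> i + k < h n"
  shows "overlap k (levs n S) (levs n R) = real (card {i \<in> R. i + k \<in> S}) / 3 ^ n"
proof -
  have "finite S" "finite R" using assms finite_subset[OF _ finite_base] by blast+
  then show ?thesis
    using overlap_pieces(2)[OF levs_borel levs_borel levs_unit levs_unit assms(3), of S R]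
      measure_pieces_levs[OF assms(1,2)] assms(1,2) by simp
qed

section \<open>Bounds on sums of overlaps\<close>

lemma sum_measure_levels_le:
  assumes "A \<in> sets borel" "A \<subseteq> {0<..<1}"
  shows "(\<Sum>i\<in>base n. measure lborel (A \<inter> lev n i)) \<le> measure lborel A"
proof -
  have "(\<Sum>i\<in>base n. measure lborel (A \<inter> lev n i)) = measure lborel (\<Union>i\<in>base n. A \<inter> lev n i)"
  proof (rule measure_UNION'[symmetric])
    show "pairwise (\<lambda>i j. disjnt (A \<inter> lev n i) (A \<inter> lev n j)) (base n)"
      using lev_disjoint base_less unfolding pairwise_def disjnt_iff by blast
  qed (use assms finite_base in \<open>auto intro!: fmeasurable_lborel_unit\<close>)
  also have "\<dots> \<le> measure lborel A"
    using assms by (intro measure_mono_fmeasurable fmeasurable_lborel_unit sets.finite_UN)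
      (auto simp: finite_base)
  finally show ?thesis .
qed

text \<open>From a given source level each target level is reached at one time at most. Bounding a
  piece by its target gives at most \<open>measure lborel A\<close> for each of the
  \<open>3 ^ n\<close> sources; bounding it by its source uses each source at most
  \<open>3 ^ n\<close> times. The two forms serve errors in the first and in the second set.\<close>

lemma sum_overlap_le:
  assumes "A \<in> sets borel" "B \<in> sets borel" "A \<subseteq> {0<..<1}" "B \<subseteq> {0<..<1}"
    and k: "\<And>i k. i \<in> base n \<Longrightarrow> k < N \<Longrightarrow> i + k < h n"
  shows "(\<Sum>k<N. overlap k A B) \<le> 3 ^ n * measure lborel A"
    and "(\<Sum>k<N. overlap k A B) \<le> 3 ^ n * measure lborel B"
proof -
  define P where "P k = {i \<in> base n. i + k \<in> base n}" for k
  have fin: "finite (P k)" for k by (simp add: P_def finite_base)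
  have overlap: "overlap k A B \<le> (\<Sum>i\<in>P k. measure lborel (piece n k A B i))" if "k < N" for k
    using overlap_pieces(2)[OF assms(1-4) k[OF _ that]] fin[of k] assms
    by (simp add: pieces_def flip: P_def) (intro measure_UNION_le, auto intro: piece_borel)
  have A: "measure lborel (piece n k A B i) \<le> measure lborel (A \<inter> lev n (i + k))" for i k
  proof (rule measure_mono_fmeasurable)
    show "piece n k A B i \<subseteq> A \<inter> lev n (i + k)" by (auto simp: piece_def lev_def)
  qed (use assms in \<open>auto intro!: piece_borel fmeasurable_lborel_unit\<close>)
  have B: "measure lborel (piece n k A B i) \<le> measure lborel (B \<inter> lev n i)" for i k
  proof -
    let ?t = "\<lambda>x. x + (l n (i + k) - l n i)"
    have "B \<inter> lev n i \<in> sets borel" using assms by auto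
    note t = translation_borel[OF this] measure_lborel_translation[OF this]
    have "?t ` (B \<inter> lev n i) \<in> fmeasurable lborel"
      by (rule fmeasurableI2[OF lev_fmeasurable[of n "i + k"]]) (use t in \<open>auto simp: lev_def\<close>)
    then have "measure lborel (piece n k A B i) \<le> measure lborel (?t ` (B \<inter> lev n i))"
      using assms by (intro measure_mono_fmeasurable) (auto simp: piece_def intro!: sets.Int t)
    then show ?thesis by (simp add: t)
  qed
  have "(\<Sum>k<N. overlap k A B) \<le> (\<Sum>k<N. \<Sum>i\<in>P k. measure lborel (A \<inter> lev n (i + k)))"
    using overlap by (intro sum_mono) (meson A lessThan_iff order_trans sum_mono)
  also have "\<dots> = (\<Sum>i\<in>base n. \<Sum>k\<in>{k \<in> {..<N}. i + k \<in> base n}. measure lborel (A \<inter> lev n (i + k)))"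
    unfolding P_def by (rule sum.swap_restrict) (auto simp: finite_base)
  also have "\<dots> \<le> (\<Sum>i\<in>base n. measure lborel A)"
  proof (rule sum_mono)
    fix i
    have "(\<Sum>k\<in>{k \<in> {..<N}. i + k \<in> base n}. measure lborel (A \<inter> lev n (i + k)))
      = (\<Sum>j\<in>(\<lambda>k. i + k) ` {k \<in> {..<N}. i + k \<in> base n}. measure lborel (A \<inter> lev n j))"
      by (subst sum.reindex) auto
    also have "\<dots> \<le> (\<Sum>j\<in>base n. measure lborel (A \<inter> lev n j))"
      by (intro sum_mono2 finite_base) auto
    finally show "(\<Sum>k\<in>{k \<in> {..<N}. i + k \<in> base n}. measure lborel (A \<inter> lev n (i + k)))
        \<le> measure lborel A"
      using sum_measure_levels_le[of A n] assms by linarith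
  qed
  finally show "(\<Sum>k<N. overlap k A B) \<le> 3 ^ n * measure lborel A"
    by (simp add: card_base)
  have "(\<Sum>k<N. overlap k A B) \<le> (\<Sum>k<N. \<Sum>i\<in>P k. measure lborel (B \<inter> lev n i))"
    using overlap by (intro sum_mono) (meson B lessThan_iff order_trans sum_mono)
  also have "\<dots> = (\<Sum>i\<in>base n. \<Sum>k\<in>{k \<in> {..<N}. i + k \<in> base n}. measure lborel (B \<inter> lev n i))"
    unfolding P_def by (rule sum.swap_restrict) (auto simp: finite_base)
  also have "\<dots> \<le> (\<Sum>i\<in>base n. 3 ^ n * measure lborel (B \<inter> lev n i))"
  proof (rule sum_mono)
    fix i
    have "card {k \<in> {..<N}. i + k \<in> base n} = card ((\<lambda>k. i + k) ` {k \<in> {..<N}. i + k \<in> base n})"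
      by (simp add: card_image)
    also have "\<dots> \<le> card (base n)"
      by (intro card_mono finite_base) auto
    also have "\<dots> = 3 ^ n" by (rule card_base)
    finally have "real (card {k \<in> {..<N}. i + k \<in> base n}) \<le> real (3 ^ n)"
      by (rule of_nat_mono)
    then have "real (card {k \<in> {..<N}. i + k \<in> base n}) \<le> 3 ^ n" by simp
    then show "(\<Sum>k\<in>{k \<in> {..<N}. i + k \<in> base n}. measure lborel (B \<inter> lev n i))
        \<le> 3 ^ n * measure lborel (B \<inter> lev n i)"
      by (simp add: mult_right_mono)
  qed
  also have "\<dots> \<le> 3 ^ n * measure lborel B"
    using sum_measure_levels_le[of B n] assms by (simp flip: sum_distrib_left)
  finally show "(\<Sum>k<N. overlap k A B) \<le> 3 ^ n * measure lborel B" .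
qed

text \<open>At least half of the \<open>9 ^ n\<close> pairs of positions satisfy
  \<open>i <= j\<close>. Each of these contributes \<open>1 / 3 ^ n\<close> at the time
  \<open>j - i\<close>, which is below \<open>h n\<close>.\<close>

lemma sum_overlap_unit_ge:
  assumes "h n \<le> N"
  shows "3 ^ n / 2 \<le> (\<Sum>k<N. overlap k {0<..<1} {0<..<1})"
proof -
  define P where "P = {(i, j) \<in> base n \<times> base n. i \<le> j}"
  define Q where "Q = (SIGMA k:{..<N}. {i \<in> base n. i + k \<in> base n})"
  have finP: "finite P" by (rule finite_subset[of _ "base n \<times> base n"]) (auto simp: P_def finite_base)
  have "card (base n \<times> base n) \<le> card (P \<union> prod.swap ` P)"
    by (rule card_mono) (use finP in \<open>auto simp: P_def image_iff\<close>)
  also have "\<dots> \<le> card P + card P"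
    by (rule order_trans[OF card_Un_le]) (auto intro: card_image_le finP)
  finally have *: "9 ^ n \<le> 2 * card P"
    by (simp add: card_cartesian_product card_base flip: power_mult_distrib)
  have "card P = card ((\<lambda>(i, j). (j - i, i)) ` P)"
    by (rule card_image[symmetric]) (auto simp: inj_on_def P_def)
  also have "\<dots> \<le> card Q"
  proof (rule card_mono)
    show "finite Q" by (auto simp: Q_def finite_base)
    show "(\<lambda>(i, j). (j - i, i)) ` P \<subseteq> Q"
      using assms by (auto simp: P_def Q_def dest: base_less)
  qed
  also have "card Q = (\<Sum>k<N. card {i \<in> base n. i + k \<in> base n})"
    unfolding Q_def by (rule card_SigmaI) (auto simp: finite_base)
  finally have **: "9 ^ n \<le> 2 * (\<Sum>k<N. card {i \<in> base n. i + k \<in> base n})"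
    using * by linarith
  have "real (9 ^ n) \<le> 2 * (\<Sum>k<N. real (card {i \<in> base n. i + k \<in> base n}))"
    using of_nat_mono[OF **, where ?'a = real] by simp
  moreover have "real (9 ^ n) = 3 ^ n * 3 ^ n"
    by (simp flip: power_mult_distrib)
  ultimately have "3 ^ n / 2 \<le> (\<Sum>k<N. real (card {i \<in> base n. i + k \<in> base n})) / 3 ^ n"
    by (simp add: field_simps)
  also have "\<dots> = (\<Sum>k<N. measure lborel (pieces n k (levs n (base n)) (levs n (base n))))"
    by (simp add: measure_pieces_levs sum_divide_distrib)
  \<comment> \<open>Only the inclusion of the pieces in the true overlap is used, so
    \<open>N\<close> may exceed the times at which the two have equal measure.\<close>
  also have "\<dots> \<le> (\<Sum>k<N. overlap k {0<..<1} {0<..<1})"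
    unfolding overlap_def
  proof (intro sum_mono measure_mono_fmeasurable image_fmeasurable)
    fix k
    show "pieces n k (levs n (base n)) (levs n (base n)) \<subseteq> {0<..<1} \<inter> (T ^^ k) ` {0<..<1}"
      using pieces_subset[of n k "levs n (base n)" "levs n (base n)"] levs_base(1)[of n] by fast
  qed (auto intro!: pieces_borel levs_borel finite_base)
  finally show ?thesis .
qed

text \<open>Squeeze \<open>A\<close> between a compact \<open>K\<close> and an open
  \<open>V\<close>, which need not contain \<open>A\<close> but contains \<open>K\<close> with small
  excess. Once levels are shorter than the distance from \<open>K\<close> to the complement of
  \<open>V\<close>, those meeting \<open>K\<close> lie in \<open>V\<close>. Validity for all large
  \<open>n\<close> gives two sets a common column.\<close>

lemma approximation:
  assumes "A \<in> sets borel" "A \<subseteq> {0<..<1}" "e > 0"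
  shows "\<forall>\<^sub>F n in sequentially. \<exists>S\<subseteq>base n. measure lborel ((A - levs n S) \<union> (levs n S - A)) < e"
proof -
  have half: "e / 2 > 0" using assms(3) by simp
  have "A \<in> sets lebesgue" using assms(1) by auto
  then obtain K where K: "closed K" "K \<subseteq> A" "A - K \<in> lmeasurable"
      "emeasure lebesgue (A - K) < ennreal (e / 2)"
    by (rule sets_lebesgue_inner_closed[OF _ half])
  have "compact K"
  proof -
    have "bounded {0<..<1::real}" using bounded_box[of 0 "1::real"] by simp
    then have "bounded K" by (rule bounded_subset) (use K(2) assms(2) in blast)
    with K(1) show ?thesis by (simp add: compact_eq_bounded_closed)
  qed
  have "K \<in> sets lebesgue" using K(1) by auto
  then obtain V where V: "open V" "K \<subseteq> V" "V - K \<in> lmeasurable"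
      "emeasure lebesgue (V - K) < ennreal (e / 2)"
    by (rule sets_lebesgue_outer_open[OF _ half])
  obtain d where d: "d > 0" "\<And>x y. x \<in> K \<Longrightarrow> y \<notin> V \<Longrightarrow> d \<le> dist x y"
  proof -
    have "closed (- V)" "K \<inter> - V = {}" using V(1,2) by auto
    from separate_compact_closed[OF \<open>compact K\<close> this] that show ?thesis by auto
  qed
  have "(\<lambda>n. 1 / 3 ^ n :: real) \<longlonglongrightarrow> 0" by real_asymp
  then have "\<forall>\<^sub>F n in sequentially. 1 / 3 ^ n < d"
    using d(1) by (intro order_tendstoD) auto
  then show ?thesis
  proof eventually_elim
    case (elim n)
    define S where "S = {i \<in> base n. lev n i \<inter> K \<noteq> {}}"
    have S: "S \<subseteq> base n" by (auto simp: S_def)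
    have SV: "levs n S \<subseteq> V"
    proof
      fix y assume "y \<in> levs n S"
      then obtain i x where "y \<in> lev n i" "x \<in> lev n i" "x \<in> K"
        by (auto simp: levs_def S_def)
      then have "dist x y < d" using elim by (auto simp: lev_def dist_real_def)
      then show "y \<in> V" using d(2) \<open>x \<in> K\<close> by force
    qed
    define Z where "Z = {0<..<1} - levs n (base n)"
    \<comment> \<open>The levels meeting \<open>K\<close> cover it except for cut points.\<close>
    have KS: "K \<subseteq> levs n S \<union> Z"
      using K(2) assms(2) by (fastforce simp: Z_def levs_def S_def)
    have Z: "finite Z" using levs_base(2) by (simp add: Z_def)
    have "(A - levs n S) \<union> (levs n S - A) \<subseteq> ((A - K) \<union> (V - K)) \<union> Z"
      using KS SV K(2) by blast
    moreover have borel: "A - K \<in> sets borel" "V - K \<in> sets borel" "Z \<in> sets borel"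
      using assms(1) K(1) V(1) finite_imp_closed[OF Z] by (auto intro!: sets.Diff)
    ultimately have "emeasure lborel ((A - levs n S) \<union> (levs n S - A))
        \<le> emeasure lborel (((A - K) \<union> (V - K)) \<union> Z)"
      by (intro emeasure_mono) auto
    also have "\<dots> = emeasure lborel ((A - K) \<union> (V - K))"
      using borel by (intro emeasure_Un_null_set finite_imp_null_set_lborel Z) auto
    also have "\<dots> \<le> emeasure lborel (A - K) + emeasure lborel (V - K)"
      using borel by (intro emeasure_subadditive) auto
    also have "\<dots> < ennreal (e / 2) + ennreal (e / 2)"
      using K(4) V(4) borel by (intro add_strict_mono) (simp_all add: emeasure_completion)
    also have "\<dots> = ennreal e"
      using assms(3) by (simp flip: ennreal_plus)
    finally have less: "emeasure lborel ((A - levs n S) \<union> (levs n S - A)) < ennreal e" .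
    then have "ennreal (measure lborel ((A - levs n S) \<union> (levs n S - A))) < ennreal e"
      by (subst emeasure_eq_ennreal_measure[symmetric]) auto
    then show ?case using S by (auto simp: ennreal_less_iff)
  qed
qed

end

section \<open>Overlaps of unions of levels\<close>

text \<open>Integer differences and real values make the counts convolvable; the double sum lets
  refinement act linearly.\<close>

definition pair_count :: "nat set \<Rightarrow> nat set \<Rightarrow> int \<Rightarrow> real"
  where "pair_count S R x = (\<Sum>j\<in>S. \<Sum>i\<in>R. of_bool (int j - int i = x))"

lemma card_eq_pair_count:
  assumes "finite S" "finite R"
  shows "real (card {i \<in> R. i + k \<in> S}) = pair_count S R (int k)"
proof -
  have "(\<Sum>j\<in>S. of_bool (int j - int i = int k)) = (of_bool (i + k \<in> S) :: real)" for i
  proof -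
    have "of_bool (int j - int i = int k) = (if j = i + k then 1 else 0 :: real)" for j
      by auto
    then show ?thesis using assms(1) by simp
  qed
  moreover have "real (card {i \<in> R. i + k \<in> S}) = (\<Sum>i\<in>R. of_bool (i + k \<in> S))"
    using sum.inter_filter[OF assms(2), of "\<lambda>_. 1 :: real" "\<lambda>i. i + k \<in> S"]
    by (simp add: of_bool_def)
  moreover have "pair_count S R (int k) = (\<Sum>i\<in>R. \<Sum>j\<in>S. of_bool (int j - int i = int k))"
    unfolding pair_count_def by (rule sum.swap)
  ultimately show ?thesis by simp
qed

context tower
begin

text \<open>Every pair of positions yields nine, one for each choice of two digits; the right side
  is 9 times \<open>conv_step\<close>.\<close>

lemma pair_count_copies:
  assumes "S \<subseteq> {..<h n}" "R \<subseteq> {..<h n}"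
  shows "pair_count (copies n S) (copies n R) x =
    (\<Sum>y\<leftarrow>[0, int (h n), 2 * int (h n) + 1]. \<Sum>z\<leftarrow>[0, int (h n), 2 * int (h n) + 1].
      pair_count S R (x - y + z))"
proof -
  define c where "c a b = (\<Sum>j\<in>S. \<Sum>i\<in>R. of_bool (int (j + a) - int (i + b) = x) :: real)" for a b
  have c: "c a b = pair_count S R (x - int a + int b)" for a b
    unfolding c_def pair_count_def by (intro sum.cong refl arg_cong[where f = of_bool]) auto
  have "pair_count (copies n S) (copies n R) x =
    (c 0 0 + c 0 (h n) + c 0 (2 * h n + 1)) + (c (h n) 0 + c (h n) (h n) + c (h n) (2 * h n + 1))
    + (c (2 * h n + 1) 0 + c (2 * h n + 1) (h n) + c (2 * h n + 1) (2 * h n + 1))"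
    unfolding pair_count_def sum_copies[OF assms(1)] sum_copies[OF assms(2)] c_def
    by (simp only: sum.distrib add_0_right)
  then show ?thesis
    unfolding c by (simp add: algebra_simps)
qed

text \<open>At \<open>p = 0\<close> the law is a point mass, and each refinement contributes one
  digit difference. Heights are reindexed from \<open>m\<close> because \<open>smooth\<close> counts
  its digits from 0.\<close>

lemma pair_count_desc:
  assumes "S \<subseteq> {..<h m}" "R \<subseteq> {..<h m}"
  shows "pair_count (desc m S p) (desc m R p) x =
    9 ^ p * (\<Sum>j\<in>S. \<Sum>i\<in>R. smooth (\<lambda>p. h (m + p)) p 0 (x - (int j - int i)))"
proof (induction p arbitrary: x)
  case 0
  have "half_binomial 0 y = of_bool (y = 0)" for y
    by (auto simp: half_binomial_def binomial_eq_0)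
  then have "half_binomial 0 (x - (int j - int i)) = of_bool (int j - int i = x)" for i j
    by simp
  then show ?case by (simp add: pair_count_def)
next
  case (Suc p)
  show ?case
    using assms
    by (simp add: pair_count_copies desc_subset Suc.IH conv_step_def sum.distrib
        sum_divide_distrib[symmetric] algebra_simps) (simp add: sum_distrib_left)
qed

text \<open>With \<open>m\<close> fixed, only finitely many translates occur, and each differs from
  the untranslated law by an l^1 null error.\<close>

lemma l1_null_correlation:
  assumes "S \<subseteq> base m" "R \<subseteq> base m"
  shows "l1_null (\<lambda>p k. (\<Sum>j\<in>S. \<Sum>i\<in>R. smooth (\<lambda>p. h (m + p)) p 0 (k - (int j - int i)))
    - real (card S) * real (card R) / 9 ^ m
      * (\<Sum>j\<in>base m. \<Sum>i\<in>base m. smooth (\<lambda>p. h (m + p)) p 0 (k - (int j - int i))))"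
proof -
  define q where "q p = smooth (\<lambda>p. h (m + p)) p 0" for p
  define c where "c = real (card S) * real (card R) / 9 ^ m"
  have fin: "finite S" "finite R" using assms finite_subset finite_base by blast+
  have null: "l1_null (\<lambda>p k. q p (k - (int j - int i)) - q p k)" for i j
    using l1_null_translates[of q "- (int j - int i)" 0]
      l1_null_smooth_difference[of "\<lambda>p. h (m + p)"]
    by (simp add: q_def diff_diff_eq2 add_diff_eq)
  \<comment> \<open>This makes the multiples of the untranslated law cancel.\<close>
  have "c * (3 ^ m * 3 ^ m) = real (card S) * real (card R)"
    by (simp add: c_def flip: power_mult_distrib)
  then have "(\<Sum>j\<in>S. \<Sum>i\<in>R. q p (k - (int j - int i)))
      - c * (\<Sum>j\<in>base m. \<Sum>i\<in>base m. q p (k - (int j - int i)))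
    = (\<Sum>j\<in>S. \<Sum>i\<in>R. q p (k - (int j - int i)) - q p k)
      + (- c) * (\<Sum>j\<in>base m. \<Sum>i\<in>base m. q p (k - (int j - int i)) - q p k)" for p k
    by (simp add: sum_subtractf card_base right_diff_distrib)
  then show ?thesis
    unfolding q_def[symmetric] c_def[symmetric]
    by (simp only:) (intro l1_null_add l1_null_cmult l1_null_sum null fin finite_base)
qed

section \<open>Stability of overlaps and correlations of level unions\<close>

lemma overlap_cong:
  assumes "A \<in> sets borel" "B \<in> sets borel" "A \<subseteq> {0<..<1}" "B \<subseteq> {0<..<1}"
    and "A \<subseteq> A'" "B \<subseteq> B'" "finite (A' - A)" "finite (B' - B)"
  shows "overlap k A' B' = overlap k A B"
  unfolding overlap_def
proof (rule lborel_almost_equal(2))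
  show "A \<inter> (T ^^ k) ` B \<in> sets borel" using assms by (intro image_borel)
  show "finite ((A' - A) \<union> (T ^^ k) ` (B' - B))" using assms by simp
qed (use assms in auto)

text \<open>Replace the first set, then the second: a point lost on the way lies over one of the
  symmetric differences. This only uses that images respect unions and inclusions.\<close>

lemma overlap_perturb:
  assumes "A \<in> sets borel" "B \<in> sets borel" "V \<in> sets borel" "W \<in> sets borel"
    and "A \<subseteq> {0<..<1}" "B \<subseteq> {0<..<1}" "V \<subseteq> {0<..<1}" "W \<subseteq> {0<..<1}"
  shows "\<bar>overlap k A B - overlap k V W\<bar>
    \<le> overlap k ((A - V) \<union> (V - A)) B + overlap k V ((B - W) \<union> (W - B))"
proof -
  define D E where "D = (A - V) \<union> (V - A)" and "E = (B - W) \<union> (W - B)"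
  have D: "D \<in> sets borel" "D \<subseteq> {0<..<1}" and E: "E \<in> sets borel" "E \<subseteq> {0<..<1}"
    using assms by (auto simp: D_def E_def)
  have le: "measure lborel P \<le> measure lborel Q + (overlap k D B + overlap k V E)"
    if sub: "P \<subseteq> Q \<union> (D \<inter> (T ^^ k) ` B \<union> V \<inter> (T ^^ k) ` E)" and P: "P \<in> sets borel"
      and Q: "Q \<in> fmeasurable lborel" for P Q
  proof -
    have fm: "D \<inter> (T ^^ k) ` B \<in> fmeasurable lborel" "V \<inter> (T ^^ k) ` E \<in> fmeasurable lborel"
      using assms D E by (auto intro: image_fmeasurable)
    then have sets: "D \<inter> (T ^^ k) ` B \<in> sets borel" "V \<inter> (T ^^ k) ` E \<in> sets borel"
      by (auto dest: fmeasurableD)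
    have "measure lborel P \<le> measure lborel (Q \<union> (D \<inter> (T ^^ k) ` B \<union> V \<inter> (T ^^ k) ` E))"
      using sub P Q fm by (intro measure_mono_fmeasurable) auto
    also have "\<dots> \<le> measure lborel Q + measure lborel (D \<inter> (T ^^ k) ` B \<union> V \<inter> (T ^^ k) ` E)"
      using Q sets by (intro measure_Un_le) (auto dest: fmeasurableD)
    also have "measure lborel (D \<inter> (T ^^ k) ` B \<union> V \<inter> (T ^^ k) ` E) \<le> overlap k D B + overlap k V E"
      unfolding overlap_def using sets by (intro measure_Un_le) auto
    finally show ?thesis by simp
  qed
  have "overlap k A B \<le> overlap k V W + (overlap k D B + overlap k V E)"
    unfolding overlap_def[of k A B] overlap_def[of k V W]
  proof (rule le)
    show "A \<inter> (T ^^ k) ` B \<subseteq> V \<inter> (T ^^ k) ` W \<union> (D \<inter> (T ^^ k) ` B \<union> V \<inter> (T ^^ k) ` E)"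
      by (auto simp: D_def E_def)
  qed (use assms in \<open>auto intro!: image_borel image_fmeasurable\<close>)
  moreover have "overlap k V W \<le> overlap k A B + (overlap k D B + overlap k V E)"
    unfolding overlap_def[of k A B] overlap_def[of k V W]
  proof (rule le)
    show "V \<inter> (T ^^ k) ` W \<subseteq> A \<inter> (T ^^ k) ` B \<union> (D \<inter> (T ^^ k) ` B \<union> V \<inter> (T ^^ k) ` E)"
      by (auto simp: D_def E_def)
  qed (use assms in \<open>auto intro!: image_borel image_fmeasurable\<close>)
  ultimately show ?thesis
    unfolding D_def[symmetric] E_def[symmetric] by linarith
qed

lemma measure_perturb:
  assumes "A \<in> sets borel" "V \<in> sets borel" "A \<subseteq> {0<..<1::real}" "V \<subseteq> {0<..<1}"
  shows "\<bar>measure lborel A - measure lborel V\<bar> \<le> measure lborel ((A - V) \<union> (V - A))"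
proof -
  have "overlap 0 Q {0<..<1} = measure lborel Q" if "Q \<subseteq> {0<..<1}" for Q
    using that by (simp add: overlap_def Int_absorb2)
  moreover have "(A - V) \<union> (V - A) \<subseteq> {0<..<1}" using assms by blast
  ultimately show ?thesis
    using overlap_perturb[of A "{0<..<1}" V "{0<..<1}" 0] assms by (simp add: overlap_def)
qed

text \<open>Refining both sets to column \<open>Suc n\<close> makes every time
  \<open>k < h n\<close> admissible, so the overlap becomes an exact count of level pairs.\<close>

lemma overlap_desc:
  assumes "S \<subseteq> base m" "R \<subseteq> base m" "Suc n = m + p" "k < h n"
  shows "overlap k (levs m S) (levs m R) =
    9 ^ p * (\<Sum>j\<in>S. \<Sum>i\<in>R. smooth (\<lambda>p. h (m + p)) p 0 (int k - (int j - int i))) / 3 ^ (m + p)"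
proof -
  have sub: "S \<subseteq> {..<h m}" "R \<subseteq> {..<h m}" using assms base_subset by blast+
  have desc: "desc m S p \<subseteq> base (m + p)" "desc m R p \<subseteq> base (m + p)"
    using desc_mono[OF assms(1)] desc_mono[OF assms(2)] by (metis desc_base)+
  then have fin: "finite (desc m S p)" "finite (desc m R p)"
    using finite_subset finite_base by blast+
  have "overlap k (levs m S) (levs m R)
      = overlap k (levs (m + p) (desc m S p)) (levs (m + p) (desc m R p))"
    using levs_desc[OF sub(1), of p] levs_desc[OF sub(2), of p] fin desc
    by (intro overlap_cong levs_borel levs_unit) auto
  also have "\<dots> = pair_count (desc m S p) (desc m R p) (int k) / 3 ^ (m + p)"
    using overlap_levs[OF desc] base_add_less[of _ n k] assms(3,4) fin
    by (simp add: card_eq_pair_count)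
  finally show ?thesis by (simp add: pair_count_desc[OF sub])
qed

lemma sum_correlation_le:
  assumes "S \<subseteq> base m" "R \<subseteq> base m" "e > 0"
  shows "\<forall>\<^sub>F n in sequentially. \<forall>N\<le>h n.
    (\<Sum>k<N. \<bar>overlap k (levs m S) (levs m R)
      - measure lborel (levs m S) * measure lborel (levs m R) * overlap k {0<..<1} {0<..<1}\<bar>)
    \<le> e * 3 ^ Suc n"
proof -
  define G where "G p k = (\<Sum>j\<in>S. \<Sum>i\<in>R. smooth (\<lambda>p. h (m + p)) p 0 (k - (int j - int i)))
    - real (card S) * real (card R) / 9 ^ m
      * (\<Sum>j\<in>base m. \<Sum>i\<in>base m. smooth (\<lambda>p. h (m + p)) p 0 (k - (int j - int i)))" for p k
  have "\<forall>\<^sub>F p in sequentially. l1_le (G p) e"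
    using l1_null_correlation[OF assms(1,2)] assms(3) unfolding l1_null_def G_def by blast
  then obtain p0 where p0: "\<And>p. p \<ge> p0 \<Longrightarrow> l1_le (G p) e"
    by (auto simp: eventually_sequentially)
  show ?thesis
    unfolding eventually_sequentially
  proof (intro exI[of _ "m + p0"] allI impI)
    fix n N assume n: "m + p0 \<le> n" and N: "N \<le> h n"
    define p where "p = Suc n - m"
    have p: "Suc n = m + p" "p \<ge> p0" using n by (auto simp: p_def)
    have summand: "\<bar>overlap k (levs m S) (levs m R)
        - measure lborel (levs m S) * measure lborel (levs m R) * overlap k {0<..<1} {0<..<1}\<bar>
      \<le> 3 ^ (m + p) * \<bar>G p (int k)\<bar>" if "k < N" for k
    proof -
      have k: "k < h n" using that N by simp
      have "overlap k {0<..<1} {0<..<1} = overlap k (levs m (base m)) (levs m (base m))"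
        using levs_base[of m] by (intro overlap_cong levs_borel finite_base) auto
      moreover have "measure lborel (levs m S) * measure lborel (levs m R)
          = real (card S) * real (card R) / 9 ^ m"
        using assms base_subset[of m] by (simp add: measure_levs flip: power_mult_distrib)
      ultimately have "overlap k (levs m S) (levs m R)
        - measure lborel (levs m S) * measure lborel (levs m R) * overlap k {0<..<1} {0<..<1}
        = 9 ^ p / 3 ^ (m + p) * G p (int k)"
        unfolding G_def using overlap_desc[OF _ _ p(1) k] assms(1,2)
        by (simp add: algebra_simps diff_divide_distrib)
      \<comment> \<open>The factor is \<open>3 ^ p / 3 ^ m\<close>; the cruder bound is independent
        of \<open>m\<close> apart from \<open>m + p = Suc n\<close>.\<close>
      moreover have "9 ^ p / 3 ^ (m + p) \<le> (3 ^ (m + p) :: real)"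
      proof -
        have "(9::real) ^ p = 3 ^ p * 3 ^ p" by (simp flip: power_mult_distrib)
        also have "\<dots> \<le> 3 ^ (m + p) * 3 ^ (m + p)" by (intro mult_mono power_increasing) auto
        finally show ?thesis by (simp add: divide_le_eq)
      qed
      then have "9 ^ p / 3 ^ (m + p) * \<bar>G p (int k)\<bar> \<le> 3 ^ (m + p) * \<bar>G p (int k)\<bar>"
        by (rule mult_right_mono) simp
      ultimately show ?thesis
        by (simp add: abs_mult)
    qed
    have "(\<Sum>k<N. \<bar>overlap k (levs m S) (levs m R)
        - measure lborel (levs m S) * measure lborel (levs m R) * overlap k {0<..<1} {0<..<1}\<bar>)
      \<le> (\<Sum>k<N. 3 ^ (m + p) * \<bar>G p (int k)\<bar>)"
      by (intro sum_mono summand) simp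
    also have "\<dots> = 3 ^ (m + p) * (\<Sum>k\<in>int ` {..<N}. \<bar>G p k\<bar>)"
      by (simp add: sum.reindex sum_distrib_left)
    also have "\<dots> \<le> 3 ^ (m + p) * e"
      using p0[OF p(2)] by (intro mult_left_mono) (auto simp: l1_le_def)
    finally show "(\<Sum>k<N. \<bar>overlap k (levs m S) (levs m R)
        - measure lborel (levs m S) * measure lborel (levs m R) * overlap k {0<..<1} {0<..<1}\<bar>)
      \<le> e * 3 ^ Suc n"
      unfolding p(1) by (simp add: mult.commute)
  qed
qed

lemma measure_le_1:
  assumes "A \<in> sets borel" "A \<subseteq> {0<..<1::real}"
  shows "measure lborel A \<le> 1"
proof -
  have "measure lborel A \<le> measure lborel {0<..<1::real}"
    using assms by (intro measure_mono_fmeasurable fmeasurable_lborel_unit) auto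
  then show ?thesis by simp
qed

section \<open>Averages for arbitrary Borel subsets of the unit interval\<close>

lemma overlap_average_tendsto:
  assumes A: "A \<in> sets borel" "A \<subseteq> {0<..<1}" and B: "B \<in> sets borel" "B \<subseteq> {0<..<1}"
  shows "(\<lambda>N. 1 / (\<Sum>k<N. overlap k {0<..<1} {0<..<1}) *
      (\<Sum>k<N. \<bar>overlap k A B - measure lborel A * measure lborel B * overlap k {0<..<1} {0<..<1}\<bar>))
    \<longlonglongrightarrow> 0"
proof (rule LIMSEQ_I)
  define u where "u k = overlap k {0<..<1} {0<..<1}" for k
  define d where "d k = \<bar>overlap k A B - measure lborel A * measure lborel B * u k\<bar>" for k
  fix r :: real assume "r > 0"
  \<comment> \<open>The errors add up to at most \<open>56 * e * a\<close> below, which is less than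
    \<open>r * a\<close> for this \<open>e\<close>.\<close>
  define e where "e = r / 100"
  have e: "e > 0" using \<open>r > 0\<close> by (simp add: e_def)
  have "\<forall>\<^sub>F n in sequentially. (\<exists>S\<subseteq>base n. measure lborel ((A - levs n S) \<union> (levs n S - A)) < e)
      \<and> (\<exists>R\<subseteq>base n. measure lborel ((B - levs n R) \<union> (levs n R - B)) < e)"
    using approximation[OF A e] approximation[OF B e] by (rule eventually_conj)
  then obtain m S R where S: "S \<subseteq> base m" "measure lborel ((A - levs m S) \<union> (levs m S - A)) < e"
    and R: "R \<subseteq> base m" "measure lborel ((B - levs m R) \<union> (levs m R - B)) < e"
    using eventually_happens'[OF sequentially_bot] by blast
  define V W where "V = levs m S" and "W = levs m R"
  have V: "V \<in> sets borel" "V \<subseteq> {0<..<1}" and W: "W \<in> sets borel" "W \<subseteq> {0<..<1}"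
    unfolding V_def W_def using S(1) R(1) finite_subset[OF _ finite_base]
    by (auto intro!: levs_borel dest: levs_unit)
  define D E where "D = (A - V) \<union> (V - A)" and "E = (B - W) \<union> (W - B)"
  have D: "D \<in> sets borel" "D \<subseteq> {0<..<1}" "measure lborel D < e"
    and E: "E \<in> sets borel" "E \<subseteq> {0<..<1}" "measure lborel E < e"
    using A B V W S R by (auto simp: D_def E_def V_def W_def)
  obtain n0 where n0: "\<And>n N. n \<ge> n0 \<Longrightarrow> N \<le> h n \<Longrightarrow>
      (\<Sum>k<N. \<bar>overlap k V W - measure lborel V * measure lborel W * u k\<bar>) \<le> e * 3 ^ Suc n"
    using sum_correlation_le[OF S(1) R(1) e] unfolding eventually_sequentially V_def W_def u_def by blast
  have prod: "\<bar>measure lborel A * measure lborel B - measure lborel V * measure lborel W\<bar> \<le> 2 * e"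
  proof -
    have "measure lborel A * measure lborel B - measure lborel V * measure lborel W
      = (measure lborel A - measure lborel V) * measure lborel B
        + measure lborel V * (measure lborel B - measure lborel W)"
      by (simp add: algebra_simps)
    also have "\<bar>\<dots>\<bar> \<le> \<bar>measure lborel A - measure lborel V\<bar> * measure lborel B
        + measure lborel V * \<bar>measure lborel B - measure lborel W\<bar>"
      by (rule order_trans[OF abs_triangle_ineq]) (simp add: abs_mult)
    also have "\<dots> \<le> e * 1 + 1 * e"
      using measure_perturb[of A V] measure_perturb[of B W] measure_le_1[of B] measure_le_1[of V]
        A B V W D(3) E(3)
      by (intro add_mono mult_mono) (auto simp: D_def E_def)
    finally show ?thesis by simp
  qed
  show "\<exists>N0. \<forall>N\<ge>N0. norm (1 / (\<Sum>k<N. overlap k {0<..<1} {0<..<1}) * (\<Sum>k<N.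
      \<bar>overlap k A B - measure lborel A * measure lborel B * overlap k {0<..<1} {0<..<1}\<bar>) - 0) < r"
    unfolding u_def[symmetric] d_def[symmetric]
  proof (intro exI[of _ "h n0"] allI impI)
    fix N assume N: "h n0 \<le> N"
    \<comment> \<open>This starts the search for the \<open>n\<close> with
      \<open>h n <= N < h (Suc n)\<close>.\<close>
    have "N < h (Suc N)"
      using seq_suble[OF h_strict_mono, of "Suc N"] by simp
    then have least: "N < h (LEAST n. N < h n)" by (rule LeastI)
    have "n0 < (LEAST n. N < h n)"
    proof (rule ccontr)
      assume "\<not> n0 < (LEAST n. N < h n)"
      then have "h (LEAST n. N < h n) \<le> h n0" by (intro h_mono) simp
      with N least show False by simp
    qed
    then obtain n where n: "(LEAST n. N < h n) = Suc n" "n0 \<le> n"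
      by (metis Suc_le_D less_Suc_eq_le Suc_le_eq)
    have hn: "h n \<le> N" "N < h (Suc n)"
      using least not_less_Least[of n "\<lambda>n. N < h n"] n(1) by auto
    define a where "a = (\<Sum>k<N. u k)"
    have a: "3 ^ n \<le> 2 * a"
      using sum_overlap_unit_ge[OF hn(1)] by (simp add: a_def u_def)
    then have a_pos: "a > 0"
      using zero_less_power[of "3::real" n] by linarith
    \<comment> \<open>Times up to \<open>h (Suc n)\<close> call for column
      \<open>Suc (Suc n)\<close>. The upper bounds thus carry \<open>9 * 3 ^ n\<close> against the
      lower bound \<open>3 ^ n / 2\<close> for \<open>a\<close>, a loss by a constant factor
      only.\<close>
    have small: "i + k < h (Suc (Suc n))" if "i \<in> base (Suc (Suc n))" "k < N" for i k
      using base_add_less[OF that(1)] that(2) hn(2) by simp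
    have u: "u k \<ge> 0" for k by (simp add: u_def overlap_def)
    have "(\<Sum>k<N. d k) \<le> (\<Sum>k<N. overlap k D B + overlap k V E + 2 * e * u k
        + \<bar>overlap k V W - measure lborel V * measure lborel W * u k\<bar>)"
    proof (rule sum_mono)
      fix k
      have "\<bar>overlap k A B - overlap k V W\<bar> \<le> overlap k D B + overlap k V E"
        unfolding D_def E_def using A B V W by (intro overlap_perturb)
      moreover have "\<bar>measure lborel A * measure lborel B * u k - measure lborel V * measure lborel W * u k\<bar>
          \<le> 2 * e * u k"
        using mult_right_mono[OF prod u] u by (simp add: abs_mult flip: left_diff_distrib)
      ultimately show "d k \<le> overlap k D B + overlap k V E + 2 * e * u k
          + \<bar>overlap k V W - measure lborel V * measure lborel W * u k\<bar>"
        unfolding d_def by linarith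
    qed
    also have "\<dots> = (\<Sum>k<N. overlap k D B) + (\<Sum>k<N. overlap k V E) + 2 * e * a
        + (\<Sum>k<N. \<bar>overlap k V W - measure lborel V * measure lborel W * u k\<bar>)"
      by (simp add: sum.distrib a_def sum_distrib_left)
    also have "\<dots> \<le> 3 ^ Suc (Suc n) * e + 3 ^ Suc (Suc n) * e + 2 * e * a + e * 3 ^ Suc (Suc n)"
    proof (intro add_mono order_refl)
      have "(\<Sum>k<N. overlap k D B) \<le> 3 ^ Suc (Suc n) * measure lborel D"
        using A B D small by (intro sum_overlap_le(1))
      also have "\<dots> \<le> 3 ^ Suc (Suc n) * e" using D(3) by (intro mult_left_mono) auto
      finally show "(\<Sum>k<N. overlap k D B) \<le> 3 ^ Suc (Suc n) * e" .
      have "(\<Sum>k<N. overlap k V E) \<le> 3 ^ Suc (Suc n) * measure lborel E"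
        using V E small by (intro sum_overlap_le(2))
      also have "\<dots> \<le> 3 ^ Suc (Suc n) * e" using E(3) by (intro mult_left_mono) auto
      finally show "(\<Sum>k<N. overlap k V E) \<le> 3 ^ Suc (Suc n) * e" .
      show "(\<Sum>k<N. \<bar>overlap k V W - measure lborel V * measure lborel W * u k\<bar>)
          \<le> e * 3 ^ Suc (Suc n)"
        using n0[of "Suc n" N] n(2) hn(2) by simp
    qed
    also have "\<dots> = 27 * e * 3 ^ n + 2 * e * a" by simp
    also have "\<dots> \<le> 27 * e * (2 * a) + 2 * e * a"
      using a e by (intro add_right_mono mult_left_mono) auto
    also have "\<dots> < r * a" using a_pos \<open>r > 0\<close> by (simp add: e_def)
    finally have "(\<Sum>k<N. d k) < r * a" .
    moreover have "(\<Sum>k<N. d k) \<ge> 0" by (intro sum_nonneg) (simp add: d_def)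
    ultimately show "norm (1 / (\<Sum>k<N. u k) * (\<Sum>k<N. d k) - 0) < r"
      using a_pos by (simp add: divide_less_eq flip: a_def)
  qed
qed

end

section \<open>Cutting into three subcolumns\<close>

lemma lefts_cut_and_stack_3:
  assumes "cut_and_stack 3 s C C'" "s 0 = 0" "s 1 = 1"
  obtains "width C' = width C / 3"
    and "\<And>i. i < height C \<Longrightarrow> lefts C' ! i = lefts C ! i"
    and "\<And>i. i < height C \<Longrightarrow> lefts C' ! (i + height C) = lefts C ! i + width C / 3"
    and "\<And>i. i < height C \<Longrightarrow> lefts C' ! (i + (2 * height C + 1)) = lefts C ! i + 2 * (width C / 3)"
proof -
  obtain sp :: "nat \<Rightarrow> real list" where sp: "\<And>k. k < 3 \<Longrightarrow> length (sp k) = s k"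
    and width: "width C' = width C / 3"
    and lefts: "lefts C' = concat (map (\<lambda>k. map (\<lambda>a. a + real k * (width C / 3)) (lefts C) @ sp k) [0..<3])"
    using assms(1) unfolding cut_and_stack_def by auto
  have "sp 0 = []" "length (sp 1) = 1" using sp[of 0] sp[of 1] assms by auto
  moreover have "[0..<3] = [0, 1, 2::nat]" by (simp add: upt_rec)
  ultimately have lefts: "lefts C' = lefts C @ map (\<lambda>a. a + width C / 3) (lefts C) @ sp 1
      @ map (\<lambda>a. a + 2 * (width C / 3)) (lefts C) @ sp 2"
    unfolding lefts by simp
  show thesis
  proof (rule that[OF width])
    fix i assume i: "i < height C"
    then have len: "i < length (lefts C)" by (simp add: height_def)
    show "lefts C' ! i = lefts C ! i"
      using len by (simp add: lefts nth_append)
    show "lefts C' ! (i + height C) = lefts C ! i + width C / 3"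
      using len by (simp add: lefts nth_append height_def)
    show "lefts C' ! (i + (2 * height C + 1)) = lefts C ! i + 2 * (width C / 3)"
      using len \<open>length (sp 1) = 1\<close> by (simp add: lefts nth_append height_def)
  qed
qed

lemma column_map_level:
  assumes "is_column C" "Suc i < height C" "x \<in> level C i"
  shows "column_map C x = Some (x - lefts C ! i + lefts C ! Suc i)"
proof -
  have "(THE i. Suc i < height C \<and> x \<in> level C i) = i"
  proof (rule the_equality)
    fix j assume j: "Suc j < height C \<and> x \<in> level C j"
    have "disjoint_family_on (level C) {..<height C}"
      using assms(1) by (simp add: is_column_def)
    then show "j = i"
      using disjoint_family_onD[of "level C" "{..<height C}" j i] assms j by auto
  qed (use assms in simp)
  then show ?thesis
    using assms by (auto simp: column_map_def Let_def)
qed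

theorem theorem6p1:
  fixes c :: nat
    and C :: "nat \<Rightarrow> column"
    and r :: "nat \<Rightarrow> nat"
    and s :: "nat \<Rightarrow> nat \<Rightarrow> nat"
    and T :: "real \<Rightarrow> real"
  assumes "c \<ge> 2"
    and "rank_one_transformation C r s T"
    and "\<And>n. r n = 3"
    and "\<And>n. s n 0 = 0"
    and "\<And>n. s n 1 = 1"
    and "\<And>n. s n 2 \<ge> 3 * height (C n) + 1"
    and "\<And>n. height (C (Suc n)) = 3 ^ c * height (C n)"
  shows "rationally_weakly_mixing (column_space C) T"
proof -
  have C0: "C 0 = \<lparr>width = 1, lefts = [0]\<rparr>"
    and cut: "\<And>n. cut_and_stack 3 (s n) (C n) (C (Suc n))"
    and map: "\<And>n. column_map (C n) \<subseteq>\<^sub>m (\<lambda>x. Some (T x))"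
    using assms(2,3) by (auto simp: rank_one_transformation_def)
  note lefts = lefts_cut_and_stack_3[OF cut assms(4,5)]
  have width: "width (C n) = 1 / 3 ^ n" for n
  proof (induction n)
    case (Suc n)
    have "width (C (Suc n)) = width (C n) / 3" by (rule lefts)
    then show ?case using Suc by simp
  qed (simp add: C0)
  have column: "is_column (C n)" for n
  proof (cases n)
    case 0
    then show ?thesis by (simp add: C0 is_column_def height_def disjoint_family_on_def)
  next
    case (Suc m)
    then show ?thesis using cut[of m] by (simp add: cut_and_stack_def)
  qed
  interpret tower "\<lambda>n. height (C n)" "\<lambda>n i. lefts (C n) ! i" T
  proof
    show "height (C 0) = 1" "lefts (C 0) ! 0 = 0" by (simp_all add: C0 height_def)
    fix n i
    \<comment> \<open>The hypothesis \<open>c >= 2\<close> enters here, as the growth factor 9 of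
      the tower.\<close>
    have "(3::nat) ^ 2 \<le> 3 ^ c" using assms(1) by (intro power_increasing) auto
    then show "9 * height (C n) \<le> height (C (Suc n))"
      unfolding assms(7) by (intro mult_right_mono) auto
    show "disjoint_family_on (\<lambda>i. {lefts (C n) ! i<..<lefts (C n) ! i + 1 / 3 ^ n}) {..<height (C n)}"
      using column[of n] by (simp add: is_column_def level_def[abs_def] width)
    show "T x = x - lefts (C n) ! i + lefts (C n) ! Suc i"
      if "Suc i < height (C n)" "x \<in> {lefts (C n) ! i<..<lefts (C n) ! i + 1 / 3 ^ n}" for x
    proof -
      have "column_map (C n) x = Some (x - lefts (C n) ! i + lefts (C n) ! Suc i)"
        using that by (intro column_map_level[OF column]) (simp_all add: level_def width)
      then show ?thesis using map[of n] by (force simp: map_le_def)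
    qed
    assume i: "i < height (C n)"
    show "lefts (C (Suc n)) ! i = lefts (C n) ! i"
      by (rule lefts[of n]) (simp add: i)
    have "lefts (C (Suc n)) ! (i + height (C n)) = lefts (C n) ! i + width (C n) / 3"
      by (rule lefts[of n]) (simp add: i)
    then show "lefts (C (Suc n)) ! (i + height (C n)) = lefts (C n) ! i + 1 / 3 ^ Suc n"
      by (simp add: width)
    have "lefts (C (Suc n)) ! (i + (2 * height (C n) + 1)) = lefts (C n) ! i + 2 * (width (C n) / 3)"
      by (rule lefts[of n]) (simp add: i)
    then show "lefts (C (Suc n)) ! (i + (2 * height (C n) + 1)) = lefts (C n) ! i + 2 / 3 ^ Suc n"
      by (simp add: width)
  qed
  define X where "X = \<Union>(column_levels C)"
  have "open X"
    unfolding X_def column_levels_def level_def by auto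
  then have X: "X \<in> sets borel" by simp
  have "level (C 0) 0 \<in> column_levels C"
    unfolding column_levels_def by (intro UN_I[of 0] imageI) (simp_all add: C0 height_def)
  then have sub: "{0<..<1} \<subseteq> X"
    by (auto simp: X_def level_def C0)
  have sets: "A \<in> sets (column_space C) \<longleftrightarrow> A \<in> sets borel \<and> A \<subseteq> X" for A
    using X by (auto simp: column_space_def sets_restrict_space_iff simp flip: X_def)
  have meas: "measure (column_space C) A = measure lborel A" if "A \<subseteq> X" for A
    using X that by (simp add: column_space_def measure_restrict_space flip: X_def)
  have emeas: "emeasure (column_space C) {0<..<1} = 1"
    using X sub by (simp add: column_space_def emeasure_restrict_space flip: X_def)
  have overlap: "measure (column_space C) (A \<inter> (T ^^ k) ` B) = overlap k A B" if "A \<subseteq> {0<..<1}" for A B k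
    unfolding overlap_def by (rule meas) (use that sub in blast)
  \<comment> \<open>The unit interval has measure 1, so the normalisation of the return coefficient
    disappears.\<close>
  have coeff: "return_coeff (column_space C) T {0<..<1} k = overlap k {0<..<1} {0<..<1}" for k
    using meas[OF sub] by (simp add: return_coeff_def overlap)
  show ?thesis
    unfolding rationally_weakly_mixing_def
  proof (intro bexI[of _ "{0<..<1}"] conjI ballI impI)
    fix A B assume AB: "A \<in> sets (column_space C)" "B \<in> sets (column_space C)"
      "A \<subseteq> {0<..<1}" "B \<subseteq> {0<..<1}"
    then have "measure (column_space C) A = measure lborel A" "measure (column_space C) B = measure lborel B"
      using sub by (auto intro!: meas)
    then show "(\<lambda>n. 1 / return_sum (column_space C) T {0<..<1} n *
        (\<Sum>k<n. \<bar>measure (column_space C) (A \<inter> (T ^^ k) ` B)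
          - measure (column_space C) A * measure (column_space C) B
            * return_coeff (column_space C) T {0<..<1} k\<bar>)) \<longlonglongrightarrow> 0"
      using overlap_average_tendsto[of A B] AB
      by (simp only: return_sum_def coeff overlap sets)
  qed (use emeas sub in \<open>auto simp: sets\<close>)
qed

end
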